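(* Let $r\ge1$ be an integer and write $G=G(r)$, with its standard generators $a_i$ ($i\ge1$) and $b_j$ ($1\le j\le r$). Let $\sim$ denote conjugacy under $W$. Consider elements $a'_i,b'_j\in W$ for all $i\ge1$ and $1\le j\le r$ which satisfy: (a) $a'_1\sim\sigma$; $a'_{r+1}\sim(a'_r,b'_r)$; $a'_i\sim(a'_{i-1},1)$ for all $i>1$ with $i\neq r+1$; $b'_1\sim\sigma$; $b'_j\sim(b'_{j-1},1)$ for all $1<j\le r$; and (b) the infinite product of all the elements $a'_i$ and $b'_j$ in some order converges to the identity element of $W$. Then there exists $w\in W$ such that for all $i\ge1$ and all $1\le j\le r$, the element $w^{-1}a'_iw$ is conjugate to $a_i$ under $G$ and the element $w^{-1}b'_jw$ is conjugate to $b_j$ under $G$. Moreover, for any such $w$ the closure of the subgroup of $W$ generated by all $a'_i$ and $b'_j$ is $wGw^{-1}$.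
   Context: Tree: $T$ is the regular rooted binary tree whose vertices are the finite words over $\{0,1\}$ (root = empty word; the children of $t$ are $t0,t1$). $W=\mathrm{Aut}(T)$ is the profinite group of automorphisms of $T$ fixing the root; $T_n$ is the truncation of $T$ at level $n$. Identifying the subtrees below the vertices $0$ and $1$ with $T$ gives $W=(W\times W)\rtimes\langle\sigma\rangle$, where $(u,v)$ acts by $u$ on the first and by $v$ on the second subtree, and $\sigma$ is the involution interchanging the two subtrees, so $\sigma(u,v)=(v,u)\sigma$. The group $G(r)$: for an integer $r\ge1$, define elements $a_i$ ($i\ge1$) and $b_j$ ($1\le j\le r$) of $W$ as the unique elements satisfying the recursion relations $a_1=\sigma$; $a_{r+1}=(a_r,b_r)$; $a_i=(a_{i-1},1)$ for all $i>1$ with $i\ne r+1$; $b_1=(b_r,b_r^{-1})\sigma$; $b_j=(b_rb_{j-1}b_r^{-1},1)$ for all $1<j\le r$. (Such relations determine unique elements of $W$, level by level.) $G(r)$ is the closure in $W$ of the subgroup generated by all $a_i$ and $b_j$. Infinite products: under condition (a), for every $n$ only finitely many of the elements $a'_i,b'_j$ act nontrivially on $T_n$. Condition (b) means that for some total ordering of the family of all $a'_i,b'_j$ ($i\ge1$, $1\le j\le r$), for every $n$ the product in that order of the finitely many restrictions to $T_n$ that are nontrivial is equal to $1$. *)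

theory Defs
  imports "HOL-Analysis.Analysis" "HOL-Algebra.Generated_Groups"
begin

section \<open>The binary tree and its automorphism group\<close>

text \<open>The letters 0 and 1 are \<open>False\<close> and \<open>True\<close>; the children of a word \<open>t\<close> are \<open>t @ [x]\<close>,
  so the subtree below the vertex \<open>x\<close> of level one consists of the words \<open>x # t\<close>.\<close>

type_synonym vertex = "bool list"

definition tree_edge :: "vertex \<Rightarrow> vertex \<Rightarrow> bool" where
  "tree_edge s t \<longleftrightarrow> (\<exists>x. t = s @ [x] \<or> s = t @ [x])"

definition tree_aut :: "(vertex \<Rightarrow> vertex) monoid" where
  "tree_aut = \<lparr>carrier = {f. bij f \<and> f [] = [] \<and> (\<forall>s t. tree_edge (f s) (f t) \<longleftrightarrow> tree_edge s t)},
     mult = (\<circ>), one = id\<rparr>"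

fun tree_pair :: "(vertex \<Rightarrow> vertex) \<Rightarrow> (vertex \<Rightarrow> vertex) \<Rightarrow> vertex \<Rightarrow> vertex" where
  "tree_pair u v [] = []"
| "tree_pair u v (False # t) = False # u t"
| "tree_pair u v (True # t) = True # v t"

fun tree_swap :: "vertex \<Rightarrow> vertex" where
  "tree_swap [] = []"
| "tree_swap (x # t) = (\<not> x) # t"

text \<open>The profinite topology: the topology of pointwise convergence, for the discrete topology
  on the vertices; see \<open>in_tree_aut_closure_iff\<close> below.\<close>

definition tree_aut_topology :: "(vertex \<Rightarrow> vertex) topology" where
  "tree_aut_topology =
     subtopology (product_topology (\<lambda>_. discrete_topology UNIV) UNIV) (carrier tree_aut)"

definition conjugate_under ::
    "(vertex \<Rightarrow> vertex) set \<Rightarrow> (vertex \<Rightarrow> vertex) \<Rightarrow> (vertex \<Rightarrow> vertex) \<Rightarrow> bool" where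
  "conjugate_under H x y \<longleftrightarrow> (\<exists>h\<in>H. x = h \<otimes>\<^bsub>tree_aut\<^esub> y \<otimes>\<^bsub>tree_aut\<^esub> inv\<^bsub>tree_aut\<^esub> h)"

abbreviation tree_conj :: "(vertex \<Rightarrow> vertex) \<Rightarrow> (vertex \<Rightarrow> vertex) \<Rightarrow> bool" (infix \<open>\<sim>\<^sub>W\<close> 50) where
  "x \<sim>\<^sub>W y \<equiv> conjugate_under (carrier tree_aut) x y"


section \<open>Families of generators\<close>

text \<open>Families \<open>a\<close> and \<open>b\<close> are functions on all of \<open>nat\<close>; only the values \<open>a i\<close> for \<open>i \<ge> 1\<close> and
  \<open>b j\<close> for \<open>1 \<le> j \<le> r\<close> are meaningful.\<close>

definition tree_aut_families ::
    "nat \<Rightarrow> (nat \<Rightarrow> vertex \<Rightarrow> vertex) \<Rightarrow> (nat \<Rightarrow> vertex \<Rightarrow> vertex) \<Rightarrow> bool" where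
  "tree_aut_families r a b \<longleftrightarrow>
     (\<forall>i\<ge>1. a i \<in> carrier tree_aut) \<and> (\<forall>j\<in>{1..r}. b j \<in> carrier tree_aut)"

text \<open>For \<open>r \<ge> 1\<close> these relations have a solution, and it is unique:
  \<open>standard_generators_exist\<close> and \<open>standard_generators_unique\<close> below.\<close>

definition standard_generators ::
    "nat \<Rightarrow> (nat \<Rightarrow> vertex \<Rightarrow> vertex) \<Rightarrow> (nat \<Rightarrow> vertex \<Rightarrow> vertex) \<Rightarrow> bool" where
  "standard_generators r a b \<longleftrightarrow>
     tree_aut_families r a b \<and>
     a 1 = tree_swap \<and>
     a (r + 1) = tree_pair (a r) (b r) \<and>
     (\<forall>i>1. i \<noteq> r + 1 \<longrightarrow> a i = tree_pair (a (i - 1)) \<one>\<^bsub>tree_aut\<^esub>) \<and>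
     b 1 = tree_pair (b r) (inv\<^bsub>tree_aut\<^esub> (b r)) \<otimes>\<^bsub>tree_aut\<^esub> tree_swap \<and>
     (\<forall>j. 1 < j \<and> j \<le> r \<longrightarrow>
        b j = tree_pair (b r \<otimes>\<^bsub>tree_aut\<^esub> b (j - 1) \<otimes>\<^bsub>tree_aut\<^esub> inv\<^bsub>tree_aut\<^esub> (b r)) \<one>\<^bsub>tree_aut\<^esub>)"

text \<open>If \<open>a\<close> and \<open>b\<close> are the standard generators, this is the group \<open>G(r)\<close>.\<close>

definition closed_subgroup_gen ::
    "nat \<Rightarrow> (nat \<Rightarrow> vertex \<Rightarrow> vertex) \<Rightarrow> (nat \<Rightarrow> vertex \<Rightarrow> vertex) \<Rightarrow> (vertex \<Rightarrow> vertex) set" where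
  "closed_subgroup_gen r a b =
     tree_aut_topology closure_of generate tree_aut (a ` {1..} \<union> b ` {1..r})"

definition conjugate_recursion ::
    "nat \<Rightarrow> (nat \<Rightarrow> vertex \<Rightarrow> vertex) \<Rightarrow> (nat \<Rightarrow> vertex \<Rightarrow> vertex) \<Rightarrow> bool" where
  "conjugate_recursion r a b \<longleftrightarrow>
     a 1 \<sim>\<^sub>W tree_swap \<and>
     a (r + 1) \<sim>\<^sub>W tree_pair (a r) (b r) \<and>
     (\<forall>i>1. i \<noteq> r + 1 \<longrightarrow> a i \<sim>\<^sub>W tree_pair (a (i - 1)) \<one>\<^bsub>tree_aut\<^esub>) \<and>
     b 1 \<sim>\<^sub>W tree_swap \<and>
     (\<forall>j. 1 < j \<and> j \<le> r \<longrightarrow> b j \<sim>\<^sub>W tree_pair (b (j - 1)) \<one>\<^bsub>tree_aut\<^esub>)"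


section \<open>Infinite products\<close>

definition nontrivial_on_level :: "nat \<Rightarrow> (vertex \<Rightarrow> vertex) \<Rightarrow> bool" where
  "nontrivial_on_level n f \<longleftrightarrow> (\<exists>t. length t \<le> n \<and> f t \<noteq> t)"

text \<open>The existence of the list \<open>ks\<close> includes that only finitely many members of the family act
  nontrivially on the truncation at level \<open>n\<close>. The list is then unique: it enumerates these
  members in increasing order.\<close>

definition ordered_product_one ::
    "'k set \<Rightarrow> ('k \<times> 'k) set \<Rightarrow> ('k \<Rightarrow> vertex \<Rightarrow> vertex) \<Rightarrow> bool" where
  "ordered_product_one K R c \<longleftrightarrow>
     (\<forall>n. \<exists>ks. distinct ks \<and> set ks = {k \<in> K. nontrivial_on_level n (c k)} \<and>
        sorted_wrt (\<lambda>k l. (k, l) \<in> R) ks \<and>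
        \<not> nontrivial_on_level n (foldr (\<lambda>k g. c k \<otimes>\<^bsub>tree_aut\<^esub> g) ks \<one>\<^bsub>tree_aut\<^esub>))"

text \<open>The index \<open>Inl i\<close> stands for the \<open>i\<close>-th member of \<open>a\<close>, and \<open>Inr j\<close> for the \<open>j\<close>-th
  member of \<open>b\<close>.\<close>

definition product_one_some_order ::
    "nat \<Rightarrow> (nat \<Rightarrow> vertex \<Rightarrow> vertex) \<Rightarrow> (nat \<Rightarrow> vertex \<Rightarrow> vertex) \<Rightarrow> bool" where
  "product_one_some_order r a b \<longleftrightarrow>
     (\<exists>R. linear_order_on ({1..} <+> {1..r}) R \<and>
        ordered_product_one ({1..} <+> {1..r}) R (case_sum a b))"


section \<open>The tree automorphisms form a group\<close>

lemma tree_aut_simps [simp]: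
  "mult tree_aut = (\<circ>)" "one tree_aut = id"
  by (simp_all add: tree_aut_def)

lemma in_tree_aut:
  "f \<in> carrier tree_aut \<longleftrightarrow>
     bij f \<and> f [] = [] \<and> (\<forall>s t. tree_edge (f s) (f t) \<longleftrightarrow> tree_edge s t)"
  by (simp add: tree_aut_def)

lemma tree_aut_inv_closed:
  assumes "f \<in> carrier tree_aut"
  shows "inv_into UNIV f \<in> carrier tree_aut"
proof -
  have b: "bij f" and e: "\<And>s t. tree_edge (f s) (f t) \<longleftrightarrow> tree_edge s t" and r: "f [] = []"
    using assms by (auto simp: in_tree_aut)
  have s: "f (inv_into UNIV f x) = x" for x
    by (simp add: b bij_is_surj surj_f_inv_f)
  show ?thesis
    unfolding in_tree_aut
  proof (intro conjI allI)
    show "bij (inv_into UNIV f)" using b by (rule bij_imp_bij_inv)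
    show "inv_into UNIV f [] = []" using inv_f_f[OF bij_is_inj[OF b], of "[]"] r by simp
    fix s t
    show "tree_edge (inv_into UNIV f s) (inv_into UNIV f t) \<longleftrightarrow> tree_edge s t"
      using e[of "inv_into UNIV f s" "inv_into UNIV f t"] by (simp add: s)
  qed
qed

lemma tree_aut_group: "group tree_aut"
proof (rule groupI)
  fix x y assume "x \<in> carrier tree_aut" "y \<in> carrier tree_aut"
  then show "x \<otimes>\<^bsub>tree_aut\<^esub> y \<in> carrier tree_aut"
    by (simp add: in_tree_aut bij_comp)
next
  fix x assume x: "x \<in> carrier tree_aut"
  then have "inv_into UNIV x \<circ> x = id"
    by (simp add: in_tree_aut bij_is_inj)
  then show "\<exists>y\<in>carrier tree_aut. y \<otimes>\<^bsub>tree_aut\<^esub> x = \<one>\<^bsub>tree_aut\<^esub>"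
    using tree_aut_inv_closed[OF x] by auto
qed (auto simp: in_tree_aut)

lemma tree_aut_inv:
  assumes "f \<in> carrier tree_aut"
  shows "inv\<^bsub>tree_aut\<^esub> f = inv_into UNIV f"
proof -
  interpret group tree_aut by (rule tree_aut_group)
  show ?thesis
    using inv_equality[of "inv_into UNIV f" f] tree_aut_inv_closed[OF assms] assms
    by (simp add: in_tree_aut bij_is_inj)
qed

lemma tree_edge_length: "tree_edge s t \<Longrightarrow> length t = Suc (length s) \<or> length s = Suc (length t)"
  by (auto simp: tree_edge_def)

lemma tree_aut_length:
  assumes f: "f \<in> carrier tree_aut"
  shows "length (f t) = length t"
proof (induction "length t" arbitrary: t rule: less_induct)
  case less
  have inj: "inj f" and r: "f [] = []" and e: "\<And>s t. tree_edge (f s) (f t) \<longleftrightarrow> tree_edge s t"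
    using f by (auto simp: in_tree_aut bij_is_inj)
  show ?case
  proof (cases t rule: rev_cases)
    case Nil then show ?thesis by (simp add: r)
  next
    case (snoc s x)
    have ls: "length (f s) = length s" using less snoc by simp
    have "tree_edge (f s) (f t)" using snoc e by (auto simp: tree_edge_def)
    then consider y where "f t = f s @ [y]" | y where "f s = f t @ [y]"
      by (auto simp: tree_edge_def)
    then show ?thesis
    proof cases
      case 1 then show ?thesis using ls snoc by simp
    next
      case 2
      then obtain s' z where s: "s = s' @ [z]"
        using ls by (cases s rule: rev_cases) auto
      have "length (f s') = length s'" using less snoc s by simp
      moreover have "tree_edge (f s') (f s)" using s e by (auto simp: tree_edge_def)
      ultimately have "f s' = f t" using 2 ls s by (auto simp: tree_edge_def)
      then have "s' = t" using inj by (simp add: inj_eq)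
      then show ?thesis using s snoc by simp
    qed
  qed
qed


section \<open>The topology\<close>

definition agree_to_level :: "nat \<Rightarrow> (vertex \<Rightarrow> vertex) \<Rightarrow> (vertex \<Rightarrow> vertex) \<Rightarrow> bool" where
  "agree_to_level n f g \<longleftrightarrow> (\<forall>t. length t \<le> n \<longrightarrow> f t = g t)"

lemma in_tree_aut_closure_iff:
  assumes S: "S \<subseteq> carrier tree_aut"
  shows "f \<in> tree_aut_topology closure_of S \<longleftrightarrow>
           f \<in> carrier tree_aut \<and> (\<forall>n. \<exists>g\<in>S. agree_to_level n g f)"
proof -
  let ?P = "product_topology (\<lambda>_::vertex. discrete_topology (UNIV::vertex set)) UNIV"
  have "f \<in> ?P closure_of S \<longleftrightarrow> (\<forall>n. \<exists>g\<in>S. agree_to_level n g f)"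
  proof
    assume L: "f \<in> ?P closure_of S"
    show "\<forall>n. \<exists>g\<in>S. agree_to_level n g f"
    proof
      fix n
      have fin: "finite {t::vertex. length t \<le> n}"
        using finite_lists_length_le[of "UNIV::bool set" n] by simp
      let ?U = "\<Pi>\<^sub>E t\<in>UNIV. if length t \<le> n then {f t} else UNIV"
      have "openin ?P ?U"
        by (rule product_topology_basis) (auto intro: finite_subset[OF _ fin])
      moreover have "f \<in> ?U" by auto
      ultimately obtain g where "g \<in> S" "g \<in> ?U" using L unfolding in_closure_of by blast
      then show "\<exists>g\<in>S. agree_to_level n g f"
        by (intro bexI[of _ g]) (auto simp: agree_to_level_def PiE_iff split: if_splits)
    qed
  next
    assume R: "\<forall>n. \<exists>g\<in>S. agree_to_level n g f"
    show "f \<in> ?P closure_of S"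
      unfolding in_closure_of
    proof (intro conjI allI impI)
      show "f \<in> topspace ?P" by (simp add: PiE_UNIV_domain)
      fix T assume T: "f \<in> T \<and> openin ?P T"
      then obtain X where X: "finite {i. X i \<noteq> UNIV}" "f \<in> Pi\<^sub>E UNIV X" "Pi\<^sub>E UNIV X \<subseteq> T"
        by (auto simp: openin_product_topology_alt)
      obtain n where n: "\<And>t. X t \<noteq> UNIV \<Longrightarrow> length t \<le> n"
        using X(1) finite_nat_set_iff_bounded_le[of "length ` {i. X i \<noteq> UNIV}"] by auto
      obtain g where g: "g \<in> S" "agree_to_level n g f" using R by blast
      have "g t \<in> X t" for t
        using n[of t] g(2) X(2) by (cases "X t = UNIV") (auto simp: agree_to_level_def PiE_iff)
      then have "g \<in> T" using X(3) by (auto simp: PiE_iff)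
      then show "\<exists>y. y \<in> S \<and> y \<in> T" using g by blast
    qed
  qed
  then show ?thesis
    unfolding tree_aut_topology_def using S
    by (simp add: closure_of_subtopology inf.absorb2)
qed


section \<open>Existence and uniqueness of the standard generators\<close>

lemma tree_pair_comp: "tree_pair u v \<circ> tree_pair u' v' = tree_pair (u \<circ> u') (v \<circ> v')"
proof
  fix t show "(tree_pair u v \<circ> tree_pair u' v') t = tree_pair (u \<circ> u') (v \<circ> v') t"
    by (cases "(u, v, t)" rule: tree_pair.cases) auto
qed

lemma tree_edge_Cons [simp]: "tree_edge (x # s) (y # t) \<longleftrightarrow> x = y \<and> tree_edge s t"
  by (auto simp: tree_edge_def)

lemma tree_edge_Nil [simp]:
  "tree_edge [] t \<longleftrightarrow> length t = 1" "tree_edge t [] \<longleftrightarrow> length t = 1"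
  by (auto simp: tree_edge_def length_Suc_conv)

lemma tree_pair_closed:
  assumes u: "u \<in> carrier tree_aut" and v: "v \<in> carrier tree_aut"
  shows "tree_pair u v \<in> carrier tree_aut"
proof -
  have bu: "bij u" and bv: "bij v" using u v by (auto simp: in_tree_aut)
  have one: "tree_pair id id = id"
  proof
    fix t show "tree_pair id id t = id t"
      by (cases "(u, v, t)" rule: tree_pair.cases) auto
  qed
  have "bij (tree_pair u v)"
  proof (rule o_bij)
    show "tree_pair (inv_into UNIV u) (inv_into UNIV v) \<circ> tree_pair u v = id"
      using bu bv one by (simp add: tree_pair_comp bij_is_inj)
    show "tree_pair u v \<circ> tree_pair (inv_into UNIV u) (inv_into UNIV v) = id"
      using bu bv one surj_iff[of u] surj_iff[of v] by (simp add: tree_pair_comp bij_is_surj)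
  qed
  moreover have "tree_edge (tree_pair u v s) (tree_pair u v t) \<longleftrightarrow> tree_edge s t" for s t
    using u v tree_aut_length[OF u] tree_aut_length[OF v]
    by (cases "(u, v, s)" rule: tree_pair.cases; cases "(u, v, t)" rule: tree_pair.cases)
       (auto simp: in_tree_aut)
  ultimately show ?thesis by (simp add: in_tree_aut)
qed

lemma tree_swap_closed: "tree_swap \<in> carrier tree_aut"
proof -
  have "tree_swap (tree_swap t) = t" for t by (cases t) auto
  then have "bij tree_swap" by (intro o_bij[of tree_swap]) auto
  moreover have "tree_edge (tree_swap s) (tree_swap t) \<longleftrightarrow> tree_edge s t" for s t
    by (cases s; cases t) auto
  ultimately show ?thesis by (simp add: in_tree_aut)
qed

lemma agree_comp:
  assumes "agree_to_level n f f'" "agree_to_level n g g'" "g \<in> carrier tree_aut"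
  shows "agree_to_level n (f \<circ> g) (f' \<circ> g')"
  unfolding agree_to_level_def
proof (intro allI impI)
  fix t :: vertex assume t: "length t \<le> n"
  then have "g t = g' t" "f (g t) = f' (g t)"
    using assms(1,2) tree_aut_length[OF assms(3), of t] by (auto simp: agree_to_level_def)
  then show "(f \<circ> g) t = (f' \<circ> g') t" by simp
qed

lemma agree_inv:
  assumes "agree_to_level n f f'" "f \<in> carrier tree_aut" "f' \<in> carrier tree_aut"
  shows "agree_to_level n (inv\<^bsub>tree_aut\<^esub> f) (inv\<^bsub>tree_aut\<^esub> f')"
proof -
  have "inv_into UNIV f t = inv_into UNIV f' t" if t: "length t \<le> n" for t
  proof -
    let ?s = "inv_into UNIV f t"
    have s: "f ?s = t" using assms(2) by (simp add: in_tree_aut bij_is_surj surj_f_inv_f)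
    then have "length ?s \<le> n" using tree_aut_length[OF assms(2), of ?s] t by simp
    then have "f' ?s = t" using assms(1) s by (simp add: agree_to_level_def)
    then show ?thesis using assms(3) by (metis bij_is_inj in_tree_aut inv_f_f)
  qed
  then show ?thesis using assms by (simp add: agree_to_level_def tree_aut_inv)
qed

lemma agree_pair:
  assumes "agree_to_level n u u'" "agree_to_level n v v'"
  shows "agree_to_level (Suc n) (tree_pair u v) (tree_pair u' v')"
  unfolding agree_to_level_def
proof (intro allI impI)
  fix t :: vertex assume "length t \<le> Suc n"
  then show "tree_pair u v t = tree_pair u' v' t"
    using assms by (cases "(u, v, t)" rule: tree_pair.cases) (auto simp: agree_to_level_def)
qed

lemma agree_refl: "agree_to_level n f f"
  by (simp add: agree_to_level_def)

definition recursion_a ::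
    "nat \<Rightarrow> (nat \<Rightarrow> vertex \<Rightarrow> vertex) \<Rightarrow> (nat \<Rightarrow> vertex \<Rightarrow> vertex) \<Rightarrow> nat \<Rightarrow> vertex \<Rightarrow> vertex" where
  "recursion_a r a b i =
     (if i = 1 then tree_swap else if i = r + 1 then tree_pair (a r) (b r)
      else tree_pair (a (i - 1)) \<one>\<^bsub>tree_aut\<^esub>)"

definition recursion_b ::
    "nat \<Rightarrow> (nat \<Rightarrow> vertex \<Rightarrow> vertex) \<Rightarrow> nat \<Rightarrow> vertex \<Rightarrow> vertex" where
  "recursion_b r b j =
     (if j = 1 then tree_pair (b r) (inv\<^bsub>tree_aut\<^esub> (b r)) \<otimes>\<^bsub>tree_aut\<^esub> tree_swap
      else tree_pair (b r \<otimes>\<^bsub>tree_aut\<^esub> b (j - 1) \<otimes>\<^bsub>tree_aut\<^esub> inv\<^bsub>tree_aut\<^esub> (b r)) \<one>\<^bsub>tree_aut\<^esub>)"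

lemma standard_generators_iff_recursion:
  assumes "r \<ge> 1"
  shows "standard_generators r a b \<longleftrightarrow> tree_aut_families r a b \<and>
           (\<forall>i\<ge>1. a i = recursion_a r a b i) \<and> (\<forall>j\<in>{1..r}. b j = recursion_b r b j)"
  (is "?L \<longleftrightarrow> ?R")
proof
  assume L: ?L
  note L = L[unfolded standard_generators_def]
  have "a i = recursion_a r a b i" if i: "i \<ge> 1" for i
  proof -
    consider "i = 1" | "i = r + 1" | "i > 1" "i \<noteq> 1" "i \<noteq> r + 1" using i by linarith
    then show ?thesis
    proof cases
      case 1
      have "recursion_a r a b 1 = tree_swap" by (simp add: recursion_a_def)
      then show ?thesis using L 1 by metis
    next
      case 2
      have "recursion_a r a b (r + 1) = tree_pair (a r) (b r)"
        using assms by (simp add: recursion_a_def)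
      then show ?thesis using L 2 by metis
    next
      case 3
      then have "recursion_a r a b i = tree_pair (a (i - 1)) \<one>\<^bsub>tree_aut\<^esub>"
        by (simp add: recursion_a_def)
      then show ?thesis using L 3 by metis
    qed
  qed
  moreover have "b j = recursion_b r b j" if "j \<in> {1..r}" for j
  proof (cases "j = 1")
    case True
    have "recursion_b r b 1 = tree_pair (b r) (inv\<^bsub>tree_aut\<^esub> (b r)) \<otimes>\<^bsub>tree_aut\<^esub> tree_swap"
      by (simp add: recursion_b_def)
    then show ?thesis using L True by metis
  next
    case False
    then have "1 < j \<and> j \<le> r" using that by simp
    moreover have "recursion_b r b j =
        tree_pair (b r \<otimes>\<^bsub>tree_aut\<^esub> b (j - 1) \<otimes>\<^bsub>tree_aut\<^esub> inv\<^bsub>tree_aut\<^esub> (b r)) \<one>\<^bsub>tree_aut\<^esub>"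
      using False by (simp add: recursion_b_def)
    ultimately show ?thesis using L by metis
  qed
  ultimately show ?R using L by blast
next
  assume R: ?R
  then have A: "\<And>i. i \<ge> 1 \<Longrightarrow> a i = recursion_a r a b i"
    and B: "\<And>j. 1 \<le> j \<Longrightarrow> j \<le> r \<Longrightarrow> b j = recursion_b r b j"
    by auto
  show ?L
    unfolding standard_generators_def
  proof (intro conjI allI impI)
    show "tree_aut_families r a b" using R by blast
    show "a 1 = tree_swap" using A[of 1] by (simp add: recursion_a_def)
    show "a (r + 1) = tree_pair (a r) (b r)"
      using A[of "r + 1"] assms by (simp add: recursion_a_def)
    show "a i = tree_pair (a (i - 1)) \<one>\<^bsub>tree_aut\<^esub>" if "1 < i" "i \<noteq> r + 1" for i
      using A[of i] that by (simp add: recursion_a_def)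
    show "b 1 = tree_pair (b r) (inv\<^bsub>tree_aut\<^esub> (b r)) \<otimes>\<^bsub>tree_aut\<^esub> tree_swap"
      using B[of 1] assms by (simp add: recursion_b_def)
    show "b j = tree_pair (b r \<otimes>\<^bsub>tree_aut\<^esub> b (j - 1) \<otimes>\<^bsub>tree_aut\<^esub> inv\<^bsub>tree_aut\<^esub> (b r)) \<one>\<^bsub>tree_aut\<^esub>"
      if "1 < j \<and> j \<le> r" for j
      using B[of j] that by (simp add: recursion_b_def)
  qed
qed

lemma recursion_closed:
  assumes "r \<ge> 1" "tree_aut_families r a b"
  shows "tree_aut_families r (recursion_a r a b) (recursion_b r b)"
proof -
  interpret group tree_aut by (rule tree_aut_group)
  have A: "\<And>i. i \<ge> 1 \<Longrightarrow> a i \<in> carrier tree_aut"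
    and B: "\<And>j. 1 \<le> j \<Longrightarrow> j \<le> r \<Longrightarrow> b j \<in> carrier tree_aut"
    using assms by (auto simp: tree_aut_families_def)
  have "recursion_a r a b i \<in> carrier tree_aut" if "i \<ge> 1" for i
    unfolding recursion_a_def using A B assms(1) that tree_swap_closed
    by (auto intro!: tree_pair_closed simp del: tree_aut_simps)
  moreover have "recursion_b r b j \<in> carrier tree_aut" if "1 \<le> j" "j \<le> r" for j
    unfolding recursion_b_def using B assms(1) that tree_swap_closed
    by (auto intro!: tree_pair_closed m_closed inv_closed simp del: tree_aut_simps)
  ultimately show ?thesis by (auto simp: tree_aut_families_def)
qed

definition families_agree where
  "families_agree r n a b a' b' \<longleftrightarrow>
     (\<forall>i\<ge>1. agree_to_level n (a i) (a' i)) \<and> (\<forall>j\<in>{1..r}. agree_to_level n (b j) (b' j))"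

lemma recursion_agree:
  assumes r: "r \<ge> 1" and ab: "tree_aut_families r a b" and ab': "tree_aut_families r a' b'"
    and ag: "families_agree r n a b a' b'"
  shows "families_agree r (Suc n) (recursion_a r a b) (recursion_b r b)
           (recursion_a r a' b') (recursion_b r b')"
proof -
  interpret group tree_aut by (rule tree_aut_group)
  have B: "\<And>j. 1 \<le> j \<Longrightarrow> j \<le> r \<Longrightarrow> b j \<in> carrier tree_aut"
    and B': "\<And>j. 1 \<le> j \<Longrightarrow> j \<le> r \<Longrightarrow> b' j \<in> carrier tree_aut"
    and ga: "\<And>i. i \<ge> 1 \<Longrightarrow> agree_to_level n (a i) (a' i)"
    and gb: "\<And>j. 1 \<le> j \<Longrightarrow> j \<le> r \<Longrightarrow> agree_to_level n (b j) (b' j)"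
    using ab ab' ag by (auto simp: tree_aut_families_def families_agree_def)
  have gi: "agree_to_level n (inv\<^bsub>tree_aut\<^esub> (b r)) (inv\<^bsub>tree_aut\<^esub> (b' r))"
    using r by (intro agree_inv gb B B') auto
  have "agree_to_level (Suc n) (recursion_a r a b i) (recursion_a r a' b' i)" if "i \<ge> 1" for i
    unfolding recursion_a_def using r that ga gb by (auto intro!: agree_pair agree_refl)
  moreover have "agree_to_level (Suc n) (recursion_b r b j) (recursion_b r b' j)"
    if j: "1 \<le> j" "j \<le> r" for j
  proof (cases "j = 1")
    case True
    then show ?thesis
      unfolding recursion_b_def using r gb gi tree_swap_closed
      by (auto intro!: agree_pair agree_refl agree_comp)
  next
    case False
    with j have j': "1 \<le> j - 1" "j - 1 \<le> r" by auto
    have ic: "inv\<^bsub>tree_aut\<^esub> (b r) \<in> carrier tree_aut"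
      using inv_closed[OF B[of r]] r by simp
    show ?thesis
      unfolding recursion_b_def using False
      by (simp, intro agree_pair agree_refl agree_comp gb gi ic B) (use r j' in auto)
  qed
  ultimately show ?thesis by (auto simp: families_agree_def)
qed

lemma standard_generators_unique:
  assumes r: "r \<ge> 1" and ab: "standard_generators r a b" and ab': "standard_generators r a' b'"
  shows "(\<forall>i\<ge>1. a i = a' i) \<and> (\<forall>j\<in>{1..r}. b j = b' j)"
proof -
  have fam: "tree_aut_families r a b" "tree_aut_families r a' b'"
    using ab ab' by (auto simp: standard_generators_def)
  have *: "families_agree r n a b a' b'" for n
  proof (induction n)
    case 0
    show ?case using fam
      by (auto simp: families_agree_def agree_to_level_def tree_aut_families_def in_tree_aut)
  next
    case (Suc n)
    from recursion_agree[OF r fam Suc] show ?case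
      using ab ab' by (auto simp: families_agree_def standard_generators_iff_recursion[OF r])
  qed
  have "a i t = a' i t" if "i \<ge> 1" for i t
    using *[of "length t"] that by (auto simp: families_agree_def agree_to_level_def)
  moreover have "b j t = b' j t" if "j \<in> {1..r}" for j t
    using *[of "length t"] that by (auto simp: families_agree_def agree_to_level_def)
  ultimately show ?thesis by blast
qed

lemma tree_aut_limit:
  assumes X: "\<And>n. X n \<in> carrier tree_aut" and ag: "\<And>n. agree_to_level n (X n) (X (Suc n))"
  shows "(\<lambda>t. X (length t) t) \<in> carrier tree_aut"
    and "agree_to_level n (\<lambda>t. X (length t) t) (X n)"
proof -
  let ?L = "\<lambda>t. X (length t) t"
  have L: "?L t = X n t" if "length t \<le> n" for t n
    using that
  proof (induction n rule: dec_induct)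
    case (step m)
    then show ?case using ag[of m] by (auto simp: agree_to_level_def)
  qed simp
  show "agree_to_level n ?L (X n)" using L by (simp add: agree_to_level_def)
  have "inj ?L"
  proof (rule injI)
    fix s t assume "?L s = ?L t"
    then have "X (max (length s) (length t)) s = X (max (length s) (length t)) t"
      by (simp add: L[of _ "max (length s) (length t)"])
    then show "s = t" using X by (meson bij_is_inj in_tree_aut injD)
  qed
  moreover have "surj ?L"
    unfolding surj_def
  proof
    fix y :: vertex
    obtain x where x: "y = X (length y) x"
      using X by (meson bij_is_surj in_tree_aut surjD)
    then have "length x = length y" using tree_aut_length[OF X] by metis
    then show "\<exists>x. y = ?L x" using x by metis
  qed
  moreover have "tree_edge (?L s) (?L t) \<longleftrightarrow> tree_edge s t" for s t
    using X[of "max (length s) (length t)"]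
    by (simp add: L[of _ "max (length s) (length t)"] in_tree_aut)
  ultimately show "?L \<in> carrier tree_aut"
    using X[of 0] by (simp add: in_tree_aut bij_def)
qed

lemma standard_generators_exist:
  assumes r: "r \<ge> 1"
  shows "\<exists>a b. standard_generators r a b"
proof -
  define X where
    "X n = ((\<lambda>(a, b). (recursion_a r a b, recursion_b r b)) ^^ n) ((\<lambda>_. id), (\<lambda>_. id))" for n
  define A where "A n = fst (X n)" for n
  define B where "B n = snd (X n)" for n
  have A_Suc: "A (Suc n) = recursion_a r (A n) (B n)" and B_Suc: "B (Suc n) = recursion_b r (B n)" for n
    by (simp_all add: A_def B_def X_def case_prod_unfold)
  have fam: "tree_aut_families r (A n) (B n)" for n
  proof (induction n)
    case 0
    show ?case
      by (simp add: A_def B_def X_def tree_aut_families_def in_tree_aut flip: id_def)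
  next
    case (Suc n)
    then show ?case using recursion_closed[OF r] by (simp add: A_Suc B_Suc)
  qed
  have ag: "families_agree r n (A n) (B n) (A (Suc n)) (B (Suc n))" for n
  proof (induction n)
    case 0
    show ?case using fam[of 0] fam[of 1]
      by (auto simp: families_agree_def agree_to_level_def tree_aut_families_def in_tree_aut)
  next
    case (Suc n)
    from recursion_agree[OF r fam fam Suc] show ?case by (simp add: A_Suc B_Suc)
  qed
  define a where "a i = (\<lambda>t. A (length t) i t)" for i
  define b where "b j = (\<lambda>t. B (length t) j t)" for j
  have a: "a i \<in> carrier tree_aut" "agree_to_level n (a i) (A n i)" if "i \<ge> 1" for i n
    using tree_aut_limit[of "\<lambda>n. A n i"] fam ag that
    by (auto simp: a_def tree_aut_families_def families_agree_def)
  have b: "b j \<in> carrier tree_aut" "agree_to_level n (b j) (B n j)" if "j \<in> {1..r}" for j n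
    using tree_aut_limit[of "\<lambda>n. B n j"] fam ag that
    by (auto simp: b_def tree_aut_families_def families_agree_def)
  have fam_ab: "tree_aut_families r a b" using a b by (auto simp: tree_aut_families_def)
  have "families_agree r n a b (A n) (B n)" for n
    using a b by (auto simp: families_agree_def)
  then have rec: "families_agree r (Suc n) (recursion_a r a b) (recursion_b r b) (A (Suc n)) (B (Suc n))" for n
    unfolding A_Suc B_Suc by (intro recursion_agree[OF r fam_ab fam])
  have "a i t = recursion_a r a b i t" if "i \<ge> 1" for i t
    using rec[of "length t"] a(2)[OF that, of "Suc (length t)"] that
    by (simp add: families_agree_def agree_to_level_def)
  moreover have "b j t = recursion_b r b j t" if "j \<in> {1..r}" for j t
    using rec[of "length t"] b(2)[OF that, of "Suc (length t)"] that
    by (simp add: families_agree_def agree_to_level_def)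
  ultimately have "standard_generators r a b"
    unfolding standard_generators_iff_recursion[OF r] using fam_ab by blast
  then show ?thesis by blast
qed

end

theory Submission
  imports Defs "HOL-Algebra.Group_Action" "HOL-Computational_Algebra.Primes"
begin

text \<open>
  Write \<open>\<rho>\<close> for the sign of the action on level \<open>r\<close>. On the generators it is nontrivial exactly at
  \<open>a\<^sub>r\<close> and \<open>b\<^sub>r\<close>, and \<open>G\<close> contains \<open>(g, h)\<close> for all \<open>g, h \<in> G\<close> with \<open>\<rho> g = \<rho> h\<close>.

  Existence of \<open>w\<close> is shown level by level. After a conjugation, \<open>a'\<^sub>1 = \<sigma>\<close> and
  \<open>b'\<^sub>1 = (c, c\<^sup>-\<^sup>1) \<sigma>\<close>, and the other elements are pairs. Moving \<open>\<sigma>\<close> to the front, the product relation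
  becomes \<open>\<sigma> (p\<^sub>0, p\<^sub>1) b'\<^sub>1 (q\<^sub>0, q\<^sub>1) = 1\<close>, that is, \<open>c = q\<^sub>0 p\<^sub>1\<close> and \<open>p\<^sub>0 q\<^sub>0 p\<^sub>1 q\<^sub>1 = 1\<close>. The second equation
  says that the components of the pairs form a family of the same kind; by induction they may
  be assumed to be conjugates under \<open>G\<close> of the generators. Exactly one of \<open>q\<^sub>0\<close>, \<open>p\<^sub>1\<close> involves a component
  of \<open>a'\<^bsub>r+1\<^esub>\<close>, so \<open>\<rho> c \<noteq> 1\<close>, which is what makes \<open>b'\<^sub>1\<close> conjugate to \<open>b\<^sub>1\<close> under \<open>G\<close>. Compactness then
  passes from finite levels to the whole tree.

  The second part only uses that \<open>G\<close> is a pro-2 group: in a finite \<open>p\<close>-group maximal subgroups are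
  normal, so replacing generators by conjugates does not change the generated group.
\<close>

section \<open>Arithmetic of automorphisms written as pairs, with or without the swap\<close>

abbreviation AutT :: "(vertex \<Rightarrow> vertex) set" where "AutT \<equiv> carrier tree_aut"

abbreviation tinv :: "(vertex \<Rightarrow> vertex) \<Rightarrow> vertex \<Rightarrow> vertex" where "tinv \<equiv> m_inv tree_aut"

lemma comp_closed [simp, intro]: "f \<in> AutT \<Longrightarrow> g \<in> AutT \<Longrightarrow> f \<circ> g \<in> AutT"
  using monoid.m_closed[OF group.is_monoid[OF tree_aut_group]] by simp

lemma id_closed [simp, intro]: "id \<in> AutT"
  by (simp add: in_tree_aut)

lemma tinv_closed [simp, intro]: "f \<in> AutT \<Longrightarrow> tinv f \<in> AutT"
  using group.inv_closed[OF tree_aut_group] by simp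

lemma tinv_apply:
  assumes "f \<in> AutT"
  shows "tinv f (f t) = t" "f (tinv f t) = t"
  using assms by (simp_all add: tree_aut_inv in_tree_aut bij_is_inj bij_is_surj surj_f_inv_f)

lemma tinv_comp_cancel [simp]:
  assumes "f \<in> AutT"
  shows "tinv f \<circ> f = id" "f \<circ> tinv f = id"
  using assms by (simp_all add: fun_eq_iff tinv_apply)

lemma tinv_unique:
  assumes "f \<circ> g = id" "f \<in> AutT" "g \<in> AutT"
  shows "tinv f = g" "tinv g = f"
  using assms by (metis comp_assoc comp_id id_comp tinv_comp_cancel)+

lemma tinv_id [simp]: "tinv id = id"
  by (rule tinv_unique(1)) simp_all

lemma tinv_tinv [simp]: "f \<in> AutT \<Longrightarrow> tinv (tinv f) = f"
  by (rule tinv_unique(1)) simp_all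

lemma tinv_comp [simp]:
  assumes "f \<in> AutT" "g \<in> AutT" shows "tinv (f \<circ> g) = tinv g \<circ> tinv f"
  using assms by (intro tinv_unique(1)) (simp_all add: fun_eq_iff tinv_apply)

lemma tree_pair_id [simp]: "tree_pair id id = id"
proof
  fix t show "tree_pair id id t = id t"
    by (cases "(id :: vertex \<Rightarrow> vertex, id :: vertex \<Rightarrow> vertex, t)" rule: tree_pair.cases) auto
qed

lemma tree_pair_eq_iff: "tree_pair u v = tree_pair u' v' \<longleftrightarrow> u = u' \<and> v = v'"
proof
  assume e: "tree_pair u v = tree_pair u' v'"
  have "tree_pair u v (x # t) = tree_pair u' v' (x # t)" for x t by (simp only: e)
  from this[of False] this[of True] show "u = u' \<and> v = v'"
    by (simp add: fun_eq_iff)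
qed simp

lemmas tree_pair_in [simp, intro] = tree_pair_closed
lemmas tree_swap_in [simp, intro] = tree_swap_closed

lemma tinv_pair [simp]:
  assumes "u \<in> AutT" "v \<in> AutT" shows "tinv (tree_pair u v) = tree_pair (tinv u) (tinv v)"
  using assms by (intro tinv_unique(1)) (simp_all add: tree_pair_comp)

lemma tree_swap_swap [simp]: "tree_swap \<circ> tree_swap = id"
proof -
  have "tree_swap (tree_swap t) = t" for t by (cases t) auto
  then show ?thesis by (simp only: fun_eq_iff o_apply id_apply simp_thms)
qed

lemma tinv_swap [simp]: "tinv tree_swap = tree_swap"
  by (rule tinv_unique(1)) simp_all

lemma swap_pair: "tree_swap \<circ> tree_pair u v = tree_pair v u \<circ> tree_swap"
proof
  fix t show "(tree_swap \<circ> tree_pair u v) t = (tree_pair v u \<circ> tree_swap) t"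
    by (cases "(u, v, t)" rule: tree_pair.cases) auto
qed

lemma tree_vertex_cases [case_names Nil False True]:
  obtains "t = []" | s where "t = False # s" | s where "t = True # s"
  by (cases t) auto

text \<open>The multiplication table of the semidirect product of \<open>W \<times> W\<close> with
  the group of order two. Later computations rewrite with it instead of evaluating at
  vertices.\<close>

lemma pair_swap_comps:
  "tree_pair u v \<circ> tree_pair u' v' = tree_pair (u \<circ> u') (v \<circ> v')"
  "tree_pair u v \<circ> (tree_pair u' v' \<circ> tree_swap) = tree_pair (u \<circ> u') (v \<circ> v') \<circ> tree_swap"
  "(tree_pair u v \<circ> tree_swap) \<circ> tree_pair u' v' = tree_pair (u \<circ> v') (v \<circ> u') \<circ> tree_swap"
  "(tree_pair u v \<circ> tree_swap) \<circ> (tree_pair u' v' \<circ> tree_swap) = tree_pair (u \<circ> v') (v \<circ> u')"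
  by (rule ext, case_tac x rule: tree_vertex_cases; simp)+

text \<open>The section (state) of \<open>f\<close> at the level-one vertex \<open>x\<close>.
  Dropping the first letter of the image makes the definition serve also for automorphisms that swap
  the two subtrees.\<close>

definition sect :: "(vertex \<Rightarrow> vertex) \<Rightarrow> bool \<Rightarrow> vertex \<Rightarrow> vertex" where
  "sect f x t = tl (f (x # t))"

lemma sect_pair [simp]: "sect (tree_pair u v) False = u" "sect (tree_pair u v) True = v"
  by (auto simp: sect_def fun_eq_iff)

lemma sect_pair_swap [simp]:
  "sect (tree_pair u v \<circ> tree_swap) False = v" "sect (tree_pair u v \<circ> tree_swap) True = u"
  by (auto simp: sect_def fun_eq_iff)

lemma aut_Nil: "f \<in> AutT \<Longrightarrow> f [] = []"
  by (simp only: in_tree_aut)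

text \<open>Edges and lengths are preserved, so the image of a word extended by one letter extends
  the image of the word.\<close>

lemma aut_Cons:
  assumes f: "f \<in> AutT"
  shows "\<exists>t'. f (x # t) = f [x] @ t'"
proof (induction t rule: rev_induct)
  case (snoc y t)
  then obtain t' where t': "f (x # t) = f [x] @ t'" by blast
  have "tree_edge (f (x # t)) (f (x # t @ [y]))"
    using f by (auto simp: in_tree_aut tree_edge_def)
  moreover have "length (f (x # t @ [y])) = Suc (length (f (x # t)))"
    using tree_aut_length[OF f] by simp
  ultimately have "\<exists>z. f (x # t @ [y]) = f (x # t) @ [z]"
    unfolding tree_edge_def by force
  then show ?case using t' by auto
qed simp

text \<open>Fixing one vertex of level one forces fixing the other. Images then keep their first
  letter, and bijectivity and edges restrict to each subtree.\<close>

lemma aut_eq_pair: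
  assumes f: "f \<in> AutT" and f0: "f [False] = [False]"
  shows "f = tree_pair (sect f False) (sect f True)" "sect f x \<in> AutT"
proof -
  have "length (f [True]) = 1" using tree_aut_length[OF f] by simp
  moreover have "f [True] \<noteq> f [False]"
    using f by (simp add: in_tree_aut bij_is_inj inj_eq)
  ultimately have "f [True] = [True]"
    using f0 by (cases "f [True]") auto
  then have fx: "f [x] = [x]" for x using f0 by (cases x) auto
  have fC: "f (x # t) = x # sect f x t" for x t
    using aut_Cons[OF f, of x t] fx[of x] by (auto simp: sect_def)
  have fN: "f [] = []" using f by (simp add: in_tree_aut)
  show "f = tree_pair (sect f False) (sect f True)"
  proof
    fix t show "f t = tree_pair (sect f False) (sect f True) t"
      by (cases "(f, f, t)" rule: tree_pair.cases) (simp_all add: fC fN)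
  qed
  have inj: "f s = f t \<Longrightarrow> s = t" for s t
    using f by (auto simp: in_tree_aut bij_is_inj inj_eq)
  have "inj (sect f x)"
    using inj[of "x # s" "x # t" for s t] by (auto simp: inj_def fC)
  moreover have "surj (sect f x)"
    unfolding surj_def
  proof
    fix y
    obtain s where s: "x # y = f s" using f by (meson bij_is_surj in_tree_aut surjD)
    then show "\<exists>t. y = sect f x t"
      by (cases s) (auto simp: fC fN)
  qed
  moreover have "sect f x [] = []" using fC[of x "[]"] fx by simp
  moreover have "tree_edge (sect f x s) (sect f x t) \<longleftrightarrow> tree_edge s t" for s t
  proof -
    have "tree_edge (f (x # s)) (f (x # t)) \<longleftrightarrow> tree_edge (x # s) (x # t)"
      using f by (auto simp: in_tree_aut)
    then show ?thesis by (simp add: fC)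
  qed
  ultimately show "sect f x \<in> AutT" by (simp add: in_tree_aut bij_def)
qed

text \<open>If \<open>f\<close> moves the vertex \<open>[False]\<close>, then
  \<open>f \<circ> tree_swap\<close> fixes it and is a pair.\<close>

lemma aut_cases [consumes 1, case_names pair swapped]:
  assumes f: "f \<in> AutT"
  obtains u v where "u \<in> AutT" "v \<in> AutT" "f = tree_pair u v"
  | u v where "u \<in> AutT" "v \<in> AutT" "f = tree_pair u v \<circ> tree_swap"
proof (cases "f [False] = [False]")
  case True
  then show ?thesis using aut_eq_pair[OF f] that(1) by blast
next
  case False
  let ?g = "f \<circ> tree_swap"
  have g: "?g \<in> AutT" using f by auto
  have l: "length (f [x]) = 1" for x using tree_aut_length[OF f] by simp
  have "f [False] = [True]"
    using False l[of False] by (cases "f [False]") auto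
  moreover have "f [True] \<noteq> f [False]"
    using f by (simp add: in_tree_aut bij_is_inj inj_eq)
  ultimately have "?g [False] = [False]"
    using l[of True] by (cases "f [True]") auto
  moreover have "?g \<circ> tree_swap = f" by (simp add: comp_assoc)
  ultimately show ?thesis using aut_eq_pair[OF g] that(2) by metis
qed

section \<open>Signs\<close>

text \<open>Whether the number of vertices of level \<open>m\<close> at which \<open>f\<close> swaps is odd: the sign of the action
  on level \<open>m + 1\<close>.\<close>

primrec parity :: "nat \<Rightarrow> (vertex \<Rightarrow> vertex) \<Rightarrow> bool" where
  "parity 0 f \<longleftrightarrow> f [False] \<noteq> [False]"
| "parity (Suc m) f \<longleftrightarrow> parity m (sect f False) \<noteq> parity m (sect f True)"

lemma parity_id [simp]: "\<not> parity m id"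
proof (induction m)
  case (Suc m)
  have s: "sect id x = id" for x by (auto simp: sect_def fun_eq_iff)
  show ?case using Suc by (simp only: parity.simps s)
qed simp

lemma parity_pair_0 [simp]:
  assumes "u \<in> AutT" shows "\<not> parity 0 (tree_pair u v)" "parity 0 (tree_pair u v \<circ> tree_swap)"
  by (simp_all only: parity.simps o_apply tree_swap.simps tree_pair.simps aut_Nil[OF assms]
      list.inject simp_thms)

lemma parity_swap_iff [simp]: "parity m tree_swap \<longleftrightarrow> m = 0"
proof (cases m)
  case (Suc k)
  have s: "sect tree_swap x = id" for x by (auto simp: sect_def fun_eq_iff)
  show ?thesis by (simp only: Suc parity.simps s) simp
qed simp

lemma parity_Suc_pair [simp]:
  "parity (Suc m) (tree_pair u v) \<longleftrightarrow> parity m u \<noteq> parity m v"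
  "parity (Suc m) (tree_pair u v \<circ> tree_swap) \<longleftrightarrow> parity m u \<noteq> parity m v"
  unfolding parity.simps sect_pair sect_pair_swap by blast+

text \<open>Signs are homomorphisms to the group of order two. The sections of
  \<open>f \<circ> g\<close> are products of sections of \<open>f\<close> and \<open>g\<close>,
  those of \<open>f\<close> being interchanged if \<open>g\<close> swaps, and this does not change
  their sum modulo two.\<close>

lemma parity_comp [simp]:
  assumes "f \<in> AutT" "g \<in> AutT"
  shows "parity m (f \<circ> g) \<longleftrightarrow> parity m f \<noteq> parity m g"
  using assms
proof (induction m arbitrary: f g)
  case 0
  show ?case
    by (rule aut_cases[OF 0(1)]; rule aut_cases[OF 0(2)])
      (simp_all only: pair_swap_comps parity_pair_0 comp_closed simp_thms)
next
  case (Suc m)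
  show ?case
    by (rule aut_cases[OF Suc(2)]; rule aut_cases[OF Suc(3)])
      (simp_all only: pair_swap_comps parity_Suc_pair comp_closed Suc.IH, blast+)
qed

lemma parity_tinv [simp]:
  assumes "f \<in> AutT" shows "parity m (tinv f) \<longleftrightarrow> parity m f"
  using parity_comp[OF assms tinv_closed[OF assms], of m] assms by simp

text \<open>Signs are continuous: \<open>parity m\<close> depends only on the images of words of
  length at most \<open>m + 1\<close>.\<close>

lemma parity_agree:
  assumes "agree_to_level n f g" "m < n" shows "parity m f \<longleftrightarrow> parity m g"
  using assms
proof (induction m arbitrary: n f g)
  case 0
  then show ?case by (auto simp: agree_to_level_def)
next
  case (Suc m)
  have "agree_to_level (n - 1) (sect f x) (sect g x)" for x
    using Suc.prems by (auto simp: agree_to_level_def sect_def)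
  then have "parity m (sect f x) \<longleftrightarrow> parity m (sect g x)" for x
    using Suc.prems by (intro Suc.IH) auto
  then show ?case by simp
qed

section \<open>Conjugation and agreement\<close>

definition tconj :: "(vertex \<Rightarrow> vertex) \<Rightarrow> (vertex \<Rightarrow> vertex) \<Rightarrow> vertex \<Rightarrow> vertex" where
  "tconj h y = h \<circ> y \<circ> tinv h"

lemma conjugate_under_iff: "conjugate_under H x y \<longleftrightarrow> (\<exists>h\<in>H. x = tconj h y)"
  by (simp add: conjugate_under_def tconj_def)

lemma tconj_closed [simp, intro]: "h \<in> AutT \<Longrightarrow> y \<in> AutT \<Longrightarrow> tconj h y \<in> AutT"
  by (simp add: tconj_def)

lemma tconj_tconj: "g \<in> AutT \<Longrightarrow> h \<in> AutT \<Longrightarrow> tconj g (tconj h y) = tconj (g \<circ> h) y"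
  by (simp add: tconj_def comp_assoc)

lemma tconj_id [simp]: "tconj id y = y" "h \<in> AutT \<Longrightarrow> tconj h id = id"
  by (simp_all add: tconj_def)

lemma tconj_cancel [simp]:
  "h \<in> AutT \<Longrightarrow> tconj h (tconj (tinv h) y) = y" "h \<in> AutT \<Longrightarrow> tconj (tinv h) (tconj h y) = y"
  by (simp_all add: tconj_tconj)

lemma tconj_comp: "h \<in> AutT \<Longrightarrow> tconj h (x \<circ> y) = tconj h x \<circ> tconj h y"
  by (simp add: tconj_def fun_eq_iff tinv_apply)

lemma tinv_tconj: "h \<in> AutT \<Longrightarrow> x \<in> AutT \<Longrightarrow> tinv (tconj h x) = tconj h (tinv x)"
  by (simp add: tconj_def comp_assoc)

lemma tconj_pair:
  assumes "g \<in> AutT" "h \<in> AutT"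
  shows "tconj (tree_pair g h) (tree_pair x y) = tree_pair (tconj g x) (tconj h y)"
  using assms by (simp add: tconj_def tree_pair_comp)

lemma tconj_swap_pair: "tconj tree_swap (tree_pair x y) = tree_pair y x"
  by (simp add: tconj_def swap_pair comp_assoc)

lemma tconj_pair_swap:
  assumes "g \<in> AutT" "h \<in> AutT"
  shows "tconj (tree_pair g h) (tree_pair x y \<circ> tree_swap)
    = tree_pair (g \<circ> x \<circ> tinv h) (h \<circ> y \<circ> tinv g) \<circ> tree_swap"
  using assms by (simp add: tconj_def pair_swap_comps)

lemma tree_conj_refl: "x \<sim>\<^sub>W x"
  unfolding conjugate_under_iff by (rule bexI[of _ id]) auto

lemma tree_conj_sym: "x \<sim>\<^sub>W y \<Longrightarrow> y \<sim>\<^sub>W x"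
  unfolding conjugate_under_iff by (metis tinv_closed tconj_cancel(2))

lemma tree_conj_trans: "x \<sim>\<^sub>W y \<Longrightarrow> y \<sim>\<^sub>W z \<Longrightarrow> x \<sim>\<^sub>W z"
  unfolding conjugate_under_iff by (metis comp_closed tconj_tconj)

lemma tree_conj_pair: "x \<sim>\<^sub>W x' \<Longrightarrow> y \<sim>\<^sub>W y' \<Longrightarrow> tree_pair x y \<sim>\<^sub>W tree_pair x' y'"
  unfolding conjugate_under_iff by (metis tconj_pair tree_pair_in)

lemma agree_sym: "agree_to_level n f g \<Longrightarrow> agree_to_level n g f"
  by (simp add: agree_to_level_def)

lemma agree_trans [trans]: "agree_to_level n f g \<Longrightarrow> agree_to_level n g h \<Longrightarrow> agree_to_level n f h"
  by (simp add: agree_to_level_def)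

lemma agree_mono: "agree_to_level n f g \<Longrightarrow> m \<le> n \<Longrightarrow> agree_to_level m f g"
  by (simp add: agree_to_level_def)

lemma agree_0 [simp]: "f \<in> AutT \<Longrightarrow> g \<in> AutT \<Longrightarrow> agree_to_level 0 f g"
  by (simp add: agree_to_level_def aut_Nil)

lemma agree_tconj:
  assumes "agree_to_level n h h'" "agree_to_level n x x'"
    and "h \<in> AutT" "h' \<in> AutT" "x \<in> AutT" "x' \<in> AutT"
  shows "agree_to_level n (tconj h x) (tconj h' x')"
  unfolding tconj_def using assms by (intro agree_comp agree_inv) auto

lemma agree_pair_iff:
  "agree_to_level (Suc n) (tree_pair u v) (tree_pair u' v') \<longleftrightarrow>
    agree_to_level n u u' \<and> agree_to_level n v v'"
proof
  assume L: "agree_to_level (Suc n) (tree_pair u v) (tree_pair u' v')"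
  have "tree_pair u v (x # t) = tree_pair u' v' (x # t)" if "length t \<le> n" for x t
    using L that by (auto simp: agree_to_level_def)
  from this[of _ False] this[of _ True] show "agree_to_level n u u' \<and> agree_to_level n v v'"
    by (simp add: agree_to_level_def)
qed (use agree_pair in blast)

section \<open>Generators of finite p-groups up to conjugation\<close>

text \<open>Otherwise \<open>M\<close> is its own normalizer, and the number of its conjugates is
  divisible by \<open>p\<close>. Under conjugation by \<open>M\<close>, the only fixed conjugate is
  \<open>M\<close> itself, so the other conjugates fall into orbits of size divisible by
  \<open>p\<close>. Then \<open>p\<close> divides both \<open>card X\<close> and
  \<open>card X - 1\<close>.\<close>

lemma (in group) p_group_maximal_subgroup_normal:
  fixes p :: nat
  assumes p: "prime p" and ord: "order G = p ^ n" and M: "subgroup M G" and ne: "M \<noteq> carrier G"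
    and max: "\<And>L. subgroup L G \<Longrightarrow> M \<subseteq> L \<Longrightarrow> L = M \<or> L = carrier G"
  shows "M \<lhd> G"
proof -
  define E where "E = {H. subgroup H G}"
  define \<phi> where "\<phi> = (\<lambda>g. \<lambda>H\<in>E. g <# H #> inv g)"
  have act: "group_action G E \<phi>"
    unfolding E_def \<phi>_def by (rule action_by_conjugation_on_subgroups_set)
  interpret act: group_action G E \<phi> by (rule act)
  interpret actM: group_action "G\<lparr>carrier := M\<rparr>" E \<phi> by (rule act.induced_action[OF M])
  have fin: "finite (carrier G)"
    using ord p by (metis card.infinite order_def power_not_zero not_prime_0)
  have ME: "M \<in> E" using M by (simp add: E_def)
  have Mc: "M \<subseteq> carrier G" using M by (rule subgroup.subset)
  have finM: "finite M" using Mc fin by (rule finite_subset)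
  have \<phi>_eq: "\<phi> g H = (\<lambda>m. g \<otimes> m \<otimes> inv g) ` H" if "H \<in> E" for g H
    using that by (auto simp: \<phi>_def l_coset_def r_coset_def)
  \<comment> \<open>The normalizer of \<open>M\<close>, as the stabilizer of \<open>M\<close> for
    conjugation on subgroups.\<close>
  define N where "N = stabilizer G \<phi> M"
  have N: "subgroup N G" unfolding N_def using ME by (rule act.stabilizer_subgroup)
  have MN: "M \<subseteq> N"
  proof
    fix m assume m: "m \<in> M"
    then have "\<phi> m M = M"
      using M ME Mc subgroup.m_inv_closed[OF M m]
      by (simp add: \<phi>_def coset_join3 coset_join2 subsetD)
    then show "m \<in> N" using m Mc by (auto simp: N_def stabilizer_def)
  qed
  show ?thesis
  proof (cases "N = carrier G")
    case True
    then have "g \<otimes> m \<otimes> inv g \<in> M" if "g \<in> carrier G" "m \<in> M" for g m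
      using that \<phi>_eq[OF ME, of g] by (auto simp: N_def stabilizer_def)
    then show ?thesis using M normal_inv_iff by blast
  next
    case False
    then have NM: "N = M" using max[OF N MN] by blast
    \<comment> \<open>The set of conjugates of \<open>M\<close>. With \<open>N = M\<close> its size
      is the index of \<open>M\<close>, a power of \<open>p\<close> greater than 1.\<close>
    define X where "X = orbit G \<phi> M"
    have "card M dvd p ^ n" using lagrange[OF M] ord by (metis dvd_triv_right)
    then obtain j where j: "card M = p ^ j" using p divides_primepow_nat by blast
    have "card M < p ^ n"
      using fin Mc ne ord by (metis order_def psubsetI psubset_card_mono)
    moreover have "card X * card M = p ^ n"
      using act.orbit_stabilizer_theorem[OF ME] NM ord by (simp add: X_def N_def)
    moreover have "card X dvd p ^ n" using \<open>card X * card M = p ^ n\<close> by (metis dvd_triv_left)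
    then obtain i where "card X = p ^ i" using p divides_primepow_nat by blast
    ultimately have pX: "p dvd card X" by (cases i) auto
    have MX: "M \<in> X" unfolding X_def using ME by (rule act.orbit_refl)
    have XE: "X \<subseteq> E" unfolding X_def orbit_def using act.element_image[OF _ ME] by auto
    have finX: "finite X" unfolding X_def orbit_def using fin by (simp add: setcompr_eq_image)
    let ?A = "G\<lparr>carrier := M\<rparr>"
    \<comment> \<open>The orbits of \<open>M\<close> on the conjugates other than
      \<open>M\<close>.\<close>
    define C where "C = orbit ?A \<phi> ` (X - {M})"
    have UC: "\<Union>C = X - {M}"
    proof
      show "X - {M} \<subseteq> \<Union>C" using XE actM.orbit_refl by (auto simp: C_def)
      show "\<Union>C \<subseteq> X - {M}"
      proof
        fix y assume "y \<in> \<Union>C"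
        then obtain x m where x: "x \<in> X" "x \<noteq> M" and m: "m \<in> M" "y = \<phi> m x"
          by (auto simp: C_def orbit_def)
        have mc: "m \<in> carrier G" using m Mc by blast
        obtain g where g: "g \<in> carrier G" "x = \<phi> g M" using x by (auto simp: X_def orbit_def)
        have "y = \<phi> (m \<otimes> g) M" using g mc m ME by (simp add: act.composition_rule)
        then have "y \<in> X" using g mc by (auto simp: X_def orbit_def)
        moreover have "y \<noteq> M"
        proof
          assume "y = M"
          then have "\<phi> (inv m) M = x"
            using act.orbit_sym_aux[OF mc] x XE m by blast
          moreover have "\<phi> (inv m) M = M"
            using subgroup.m_inv_closed[OF M m(1)] MN by (auto simp: N_def stabilizer_def)
          ultimately show False using x by simp
        qed
        ultimately show "y \<in> X - {M}" by blast
      qed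
    qed
    have "p dvd card (\<Union>C)"
    proof (rule dvd_partition)
      show "finite (\<Union>C)" using UC finX by simp
      show "\<forall>c1\<in>C. \<forall>c2\<in>C. c1 \<noteq> c2 \<longrightarrow> c1 \<inter> c2 = {}"
        using XE actM.disjoint_union by (fastforce simp: C_def orbits_def)
      show "\<forall>c\<in>C. p dvd card c"
      proof
        fix c assume "c \<in> C"
        then obtain x where x: "x \<in> X" "x \<noteq> M" and c: "c = orbit ?A \<phi> x" by (auto simp: C_def)
        have xE: "x \<in> E" using x XE by blast
        have "card c * card (stabilizer ?A \<phi> x) = p ^ j"
          using actM.orbit_stabilizer_theorem[OF xE] j c by (simp add: order_def)
        then have "card c dvd p ^ j" by (metis dvd_triv_left)
        then obtain k where k: "card c = p ^ k" using p divides_primepow_nat by blast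
        show "p dvd card c"
        proof (rule ccontr)
          assume "\<not> p dvd card c"
          then have "card c = 1" using k by (cases k) auto
          moreover have "x \<in> c" unfolding c using xE by (rule actM.orbit_refl)
          ultimately have "c = {x}" by (metis card_1_singletonE singletonD)
          then have fix_x: "\<phi> m x = x" if "m \<in> M" for m using that c by (auto simp: orbit_def)
          obtain g where g: "g \<in> carrier G" "x = \<phi> g M" using x by (auto simp: X_def orbit_def)
          \<comment> \<open>If \<open>M\<close> normalizes \<open>x\<close>, which is the conjugate
            of \<open>M\<close> by \<open>g\<close>, then conjugating back by \<open>g\<close> shows
            that elements of \<open>M\<close> go into the normalizer of \<open>M\<close>, that is,
            into \<open>M\<close>. Comparing cardinalities then gives \<open>x = M\<close>.\<close>
          have "M \<subseteq> x"
          proof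
            fix m assume m: "m \<in> M"
            then have mc: "m \<in> carrier G" using Mc by blast
            have "\<phi> (inv g \<otimes> m \<otimes> g) M = \<phi> (inv g) (\<phi> m (\<phi> g M))"
              using g mc ME act.element_image[OF g(1) ME]
              by (simp add: act.composition_rule)
            also have "\<dots> = M"
              using fix_x[OF m] act.orbit_sym_aux[OF g(1) ME] g by simp
            finally have "inv g \<otimes> m \<otimes> g \<in> M"
              using NM g mc by (auto simp: N_def stabilizer_def)
            moreover have "m = g \<otimes> (inv g \<otimes> m \<otimes> g) \<otimes> inv g"
              using conjugation_is_surj[OF g(1) mc] by simp
            ultimately show "m \<in> x" unfolding g(2) \<phi>_eq[OF ME] by blast
          qed
          moreover have "finite x" "card x \<le> card M"
            unfolding g(2) \<phi>_eq[OF ME] using finM card_image_le by auto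
          ultimately have "M = x" by (intro card_seteq) auto
          then show False using x by simp
        qed
      qed
    qed
    then have "p dvd card X - 1" using UC MX finX by simp
    moreover have "card X \<ge> 1" using MX finX by (metis One_nat_def Suc_leI card_gt_0_iff empty_iff)
    ultimately have "p dvd 1" using pX by (metis dvd_diffD1)
    then show ?thesis using p by (simp add: not_prime_unit)
  qed
qed

text \<open>If the conjugates generated a proper subgroup, a maximal subgroup containing them would
  be normal, hence would contain the original generators as well.\<close>

lemma (in group) p_group_generate_conjugates:
  fixes p :: nat
  assumes p: "prime p" and ord: "order G = p ^ n"
    and S: "\<And>k. k \<in> I \<Longrightarrow> s k \<in> carrier G" and gen: "generate G (s ` I) = carrier G"
    and g: "\<And>k. k \<in> I \<Longrightarrow> g k \<in> carrier G" and t: "\<And>k. k \<in> I \<Longrightarrow> t k = g k \<otimes> s k \<otimes> inv (g k)"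
  shows "generate G (t ` I) = carrier G"
proof (rule ccontr)
  assume ne: "generate G (t ` I) \<noteq> carrier G"
  have T: "t ` I \<subseteq> carrier G" using S g t by auto
  define A where "A = {L. subgroup L G \<and> generate G (t ` I) \<subseteq> L \<and> L \<noteq> carrier G}"
  have fin: "finite (carrier G)"
    using ord p by (metis card.infinite order_def power_not_zero not_prime_0)
  then have "finite A"
    by (rule finite_subset[rotated, OF finite_Pow_iff[THEN iffD2]]) (auto simp: A_def dest: subgroup.subset)
  moreover have "generate G (t ` I) \<in> A" using ne T generate_is_subgroup by (simp add: A_def)
  ultimately obtain M where M: "M \<in> A" "\<And>L. L \<in> A \<Longrightarrow> M \<subseteq> L \<Longrightarrow> L = M"
    by (metis finite_has_maximal2)
  have "M \<lhd> G"
  proof (rule p_group_maximal_subgroup_normal[OF p ord])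
    show "L = M \<or> L = carrier G" if "subgroup L G" "M \<subseteq> L" for L
      using that M(2)[of L] M(1) by (auto simp: A_def)
  qed (use M(1) in \<open>auto simp: A_def\<close>)
  have "s k \<in> M" if "k \<in> I" for k
  proof -
    have "t k \<in> M" using M(1) that by (auto simp: A_def intro: generate.incl)
    then have "inv (g k) \<otimes> t k \<otimes> g k \<in> M"
      using \<open>M \<lhd> G\<close> g[OF that] by (metis inv_closed inv_inv normal_inv_iff)
    moreover have "inv (g k) \<otimes> t k \<otimes> g k = s k"
      using conjugation_is_surj[of "inv (g k)" "s k"] S g that by (simp add: t)
    ultimately show ?thesis by simp
  qed
  then have "generate G (s ` I) \<subseteq> M"
    using M(1) by (intro generate_subgroup_incl) (auto simp: A_def)
  then show False using M(1) gen by (auto simp: A_def dest: subgroup.subset)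
qed

section \<open>Compactness and finite levels\<close>

text \<open>Compactness of \<open>W\<close> by a diagonal argument: there are only finitely many
  actions on each level, so infinite index sets can be shrunk successively until all their members
  agree to level \<open>n\<close>.\<close>

lemma aut_accumulation_point:
  assumes x: "\<And>n. x n \<in> AutT"
  shows "\<exists>y\<in>AutT. \<forall>n. \<exists>m\<ge>n. agree_to_level n (x m) y"
proof -
  define B where "B n = {t::vertex. length t \<le> n}" for n
  define P where "P n M \<longleftrightarrow> infinite M \<and> (\<forall>i\<in>M. \<forall>j\<in>M. agree_to_level n (x i) (x j))" for n M
  have step: "\<exists>M'. M' \<subseteq> M \<and> P n M'" if M: "infinite M" for n and M :: "nat set"
  proof -
    have fin: "finite (B n)"
      unfolding B_def using finite_lists_length_le[of "UNIV::bool set" n] by simp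
    \<comment> \<open>Automorphisms preserve length, so the restrictions are self-maps of a finite
      set and the pigeonhole principle applies.\<close>
    have "(\<lambda>m. restrict (x m) (B n)) ` M \<subseteq> B n \<rightarrow>\<^sub>E B n"
      using tree_aut_length[OF x] by (auto simp: B_def split: if_splits)
    then have "finite ((\<lambda>m. restrict (x m) (B n)) ` M)"
      by (rule finite_subset) (use fin in \<open>simp add: finite_PiE\<close>)
    then obtain a where a: "a \<in> M" "infinite {m \<in> M. restrict (x m) (B n) = restrict (x a) (B n)}"
      using pigeonhole_infinite[OF M] by blast
    have "agree_to_level n (x i) (x a)" if "restrict (x i) (B n) = restrict (x a) (B n)" for i
      unfolding agree_to_level_def
    proof (intro allI impI)
      fix t :: vertex assume "length t \<le> n"
      then show "x i t = x a t" using fun_cong[OF that, of t] by (simp add: B_def)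
    qed
    then have "P n {m \<in> M. restrict (x m) (B n) = restrict (x a) (B n)}"
      unfolding P_def using a agree_sym agree_trans by blast
    then show ?thesis by (intro exI[of _ "{m \<in> M. restrict (x m) (B n) = restrict (x a) (B n)}"] conjI) auto
  qed
  have "\<exists>M. \<forall>n. P n (M n) \<and> M (Suc n) \<subseteq> M n"
  proof (rule dependent_nat_choice)
    show "\<exists>M. P 0 M" using step[OF infinite_UNIV_nat, of 0] by blast
    show "\<exists>M'. P (Suc n) M' \<and> M' \<subseteq> M" if "P n M" for M n
    proof -
      have "infinite M" using that unfolding P_def by blast
      then show ?thesis using step[of M "Suc n"] by blast
    qed
  qed
  then obtain M where M: "\<And>n. P n (M n)" "\<And>n. M (Suc n) \<subseteq> M n" by blast
  have "\<exists>m. m \<in> M n \<and> n \<le> m" for n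
    using M(1)[of n] unfolding P_def infinite_nat_iff_unbounded_le by blast
  \<comment> \<open>Taking \<open>m n \<ge> n\<close> makes the point an accumulation point along
    arbitrarily large indices.\<close>
  then obtain m where m: "\<And>n. m n \<in> M n" "\<And>n. n \<le> m n" by metis
  have ag: "agree_to_level n (x (m n)) (x (m (Suc n)))" for n
  proof -
    have "m (Suc n) \<in> M n" using m(1)[of "Suc n"] M(2) by blast
    then show ?thesis using M(1)[of n] m(1)[of n] unfolding P_def by blast
  qed
  define y where "y = (\<lambda>t. x (m (length t)) t)"
  have y: "y \<in> AutT" and yx: "agree_to_level n y (x (m n))" for n
    using tree_aut_limit[of "\<lambda>n. x (m n)", OF x ag] by (simp_all add: y_def)
  have "\<exists>k\<ge>n. agree_to_level n (x k) y" for n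
    using m(2)[of n] agree_sym[OF yx[of n]] by blast
  then show ?thesis using y by blast
qed

text \<open>The action on the truncation at level \<open>n\<close>, extended by fixing all longer
  words. The result is in general not a tree automorphism, which is why \<open>level_group n\<close>
  is a group of its own.\<close>

definition truncate_aut :: "nat \<Rightarrow> (vertex \<Rightarrow> vertex) \<Rightarrow> vertex \<Rightarrow> vertex" where
  "truncate_aut n f = (\<lambda>t. if length t \<le> n then f t else t)"

definition level_group :: "nat \<Rightarrow> (vertex \<Rightarrow> vertex) monoid" where
  "level_group n = \<lparr>carrier = truncate_aut n ` AutT, mult = (\<circ>), one = id\<rparr>"

lemma truncate_aut_eq_iff: "truncate_aut n f = truncate_aut n g \<longleftrightarrow> agree_to_level n f g"
  by (auto simp: truncate_aut_def agree_to_level_def fun_eq_iff)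

lemma truncate_aut_comp:
  assumes "g \<in> AutT" shows "truncate_aut n (f \<circ> g) = truncate_aut n f \<circ> truncate_aut n g"
  using tree_aut_length[OF assms] by (auto simp: truncate_aut_def fun_eq_iff)

lemma truncate_aut_id: "truncate_aut n id = id"
  by (auto simp: truncate_aut_def)

lemma level_group_group: "group (level_group n)"
proof (rule groupI)
  fix x assume "x \<in> carrier (level_group n)"
  then obtain f where f: "f \<in> AutT" "x = truncate_aut n f" by (auto simp: level_group_def)
  then have "truncate_aut n (tinv f) \<circ> x = id"
    by (simp add: truncate_aut_id flip: truncate_aut_comp)
  then show "\<exists>y\<in>carrier (level_group n). y \<otimes>\<^bsub>level_group n\<^esub> x = \<one>\<^bsub>level_group n\<^esub>"
    using f by (auto simp: level_group_def)
next
  fix x y assume "x \<in> carrier (level_group n)" "y \<in> carrier (level_group n)"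
  then show "x \<otimes>\<^bsub>level_group n\<^esub> y \<in> carrier (level_group n)"
    by (auto simp: level_group_def simp flip: truncate_aut_comp)
qed (auto simp: level_group_def comp_assoc intro!: image_eqI[of id _ id] simp: truncate_aut_id)

lemma truncate_aut_hom: "group_hom tree_aut (level_group n) (truncate_aut n)"
  by (intro group_hom.intro group_hom_axioms.intro tree_aut_group level_group_group homI)
    (auto simp: level_group_def truncate_aut_comp)

text \<open>By the decomposition into pairs and swapped pairs, the order at level
  \<open>n + 1\<close> is twice the square of the order at level \<open>n\<close>.\<close>

lemma order_level_group: "\<exists>k. order (level_group n) = 2 ^ k"
proof -
  have "\<exists>k. card (truncate_aut n ` AutT) = 2 ^ k"
  proof (induction n)
    case 0
    have "truncate_aut 0 ` AutT = {id}"
      by (force simp: truncate_aut_def aut_Nil fun_eq_iff image_iff)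
    then show ?case by (intro exI[of _ 0]) simp
  next
    case (Suc n)
    then obtain k where k: "card (truncate_aut n ` AutT) = 2 ^ k" by blast
    define A where "A = truncate_aut n ` AutT"
    have A_long: "u t = t" if "u \<in> A" "length t > n" for u t
      using that by (auto simp: A_def truncate_aut_def)
    define p where "p = (\<lambda>(u, v). tree_pair u v)"
    \<comment> \<open>The outer truncation matters here: without it the swap would still change the
      first letter of words longer than \<open>n + 1\<close>.\<close>
    define q where "q = (\<lambda>(u, v). truncate_aut (Suc n) (tree_pair u v \<circ> tree_swap))"
    have tp: "truncate_aut (Suc n) (tree_pair u v) = tree_pair (truncate_aut n u) (truncate_aut n v)" for u v
      by (rule ext, case_tac x rule: tree_vertex_cases) (simp_all add: truncate_aut_def)
    have ts: "truncate_aut (Suc n) (tree_pair u v \<circ> tree_swap)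
        = truncate_aut (Suc n) (tree_pair (truncate_aut n u) (truncate_aut n v) \<circ> tree_swap)" for u v
      by (rule ext, case_tac x rule: tree_vertex_cases) (simp_all add: truncate_aut_def)
    have "truncate_aut (Suc n) ` AutT = p ` (A \<times> A) \<union> q ` (A \<times> A)"
    proof (intro equalityI subsetI)
      fix x assume "x \<in> truncate_aut (Suc n) ` AutT"
      then obtain f where f: "f \<in> AutT" "x = truncate_aut (Suc n) f" by blast
      from f(1) show "x \<in> p ` (A \<times> A) \<union> q ` (A \<times> A)"
      proof (cases rule: aut_cases)
        case (pair u v)
        then have "x = p (truncate_aut n u, truncate_aut n v)" using f tp by (simp add: p_def)
        then show ?thesis using pair by (auto simp: A_def)
      next
        case (swapped u v)
        then have "x = q (truncate_aut n u, truncate_aut n v)" using f ts by (simp add: q_def)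
        then show ?thesis using swapped by (auto simp: A_def)
      qed
    next
      fix x assume "x \<in> p ` (A \<times> A) \<union> q ` (A \<times> A)"
      then obtain u v where uv: "u \<in> AutT" "v \<in> AutT" and
        "x = p (truncate_aut n u, truncate_aut n v) \<or> x = q (truncate_aut n u, truncate_aut n v)"
        by (auto simp: A_def)
      then have "x = truncate_aut (Suc n) (tree_pair u v) \<or> x = truncate_aut (Suc n) (tree_pair u v \<circ> tree_swap)"
        using tp ts by (simp add: p_def q_def)
      then show "x \<in> truncate_aut (Suc n) ` AutT" using uv by auto
    qed
    moreover have "inj_on p (A \<times> A)" by (auto simp: inj_on_def p_def tree_pair_eq_iff)
    moreover have "inj_on q (A \<times> A)"
    proof (rule inj_onI)
      fix z z' assume z: "z \<in> A \<times> A" "z' \<in> A \<times> A" "q z = q z'"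
      obtain u v u' v' where uv: "z = (u, v)" "z' = (u', v')" by (metis surj_pair)
      have e: "q (u, v) (x # t) = q (u', v') (x # t)" for x t using z(3) uv by simp
      have "u t = u' t" "v t = v' t" for t
        using e[of True t] e[of False t] A_long[of u t] A_long[of u' t] A_long[of v t] A_long[of v' t] z uv
        by (cases "length t \<le> n"; simp add: q_def truncate_aut_def)+
      then show "z = z'" using uv by (simp add: fun_eq_iff)
    qed
    moreover have "p ` (A \<times> A) \<inter> q ` (A \<times> A) = {}"
    proof -
      have "p z [False] \<noteq> q z' [False]" for z z'
        by (cases z; cases z') (simp add: p_def q_def truncate_aut_def)
      then have "p z \<noteq> q z'" for z z' by metis
      then show ?thesis by blast
    qed
    moreover have "finite A" using k unfolding A_def by (metis card.infinite power_not_zero zero_neq_numeral)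
    ultimately have "card (truncate_aut (Suc n) ` AutT) = 2 ^ (k + k + 1)"
      using k by (simp add: card_Un_disjoint card_image card_cartesian_product power_add flip: A_def)
    then show ?case by blast
  qed
  then show ?thesis by (simp add: order_def level_group_def)
qed

text \<open>Reduced to level \<open>n\<close>, the group generated by \<open>s\<close> becomes a
  finite 2-group in which the images of \<open>t\<close> are conjugates of the generators. Agreement
  is asked only to level \<open>n\<close>, so that conjugators from a closure can be replaced by
  approximations from the generated group.\<close>

lemma conjugates_generate_to_level:
  assumes s: "\<And>k. k \<in> I \<Longrightarrow> s k \<in> AutT" and t: "\<And>k. k \<in> I \<Longrightarrow> t k \<in> AutT"
    and g: "\<And>k. k \<in> I \<Longrightarrow> g k \<in> generate tree_aut (s ` I)"
    and ag: "\<And>k. k \<in> I \<Longrightarrow> agree_to_level n (t k) (tconj (g k) (s k))"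
    and y: "y \<in> generate tree_aut (s ` I)"
  shows "\<exists>h\<in>generate tree_aut (t ` I). agree_to_level n h y"
proof -
  interpret W: group tree_aut by (rule tree_aut_group)
  interpret L: group "level_group n" by (rule level_group_group)
  interpret hom: group_hom tree_aut "level_group n" "truncate_aut n" by (rule truncate_aut_hom)
  have sI: "s ` I \<subseteq> AutT" and tI: "t ` I \<subseteq> AutT" using s t by auto
  define H where "H = truncate_aut n ` generate tree_aut (s ` I)"
  \<comment> \<open>The image is treated as a group in its own right, because conjugation has to
    take place inside the group that \<open>s\<close> generates.\<close>
  define Q where "Q = (level_group n)\<lparr>carrier := H\<rparr>"
  have H: "subgroup H (level_group n)"
    unfolding H_def by (intro hom.subgroup_img_is_subgroup W.generate_is_subgroup sI)
  have mult_Q: "mult Q = (\<circ>)" by (simp add: Q_def level_group_def)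
  interpret Q: group Q unfolding Q_def using H by (rule L.subgroup_imp_group)
  have gen: "generate Q K = generate (level_group n) K" if "K \<subseteq> H" for K
    unfolding Q_def using that H by (rule L.generate_consistent)
  obtain k where "order (level_group n) = 2 ^ k" using order_level_group by blast
  then have "card H dvd 2 ^ k" using L.lagrange[OF H] by (metis dvd_triv_right)
  then obtain j where "card H = 2 ^ j" using divides_primepow_nat two_is_prime_nat by blast
  then have ord: "order Q = 2 ^ j" by (simp add: order_def Q_def)
  have gA: "g k \<in> AutT" if "k \<in> I" for k using g[OF that] sI W.generate_incl by blast
  have sH: "truncate_aut n (s k) \<in> H" if "k \<in> I" for k
    unfolding H_def using that by (auto intro: generate.incl)
  have gH: "truncate_aut n (g k) \<in> H" if "k \<in> I" for k
    unfolding H_def using g that by auto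
  have tr: "truncate_aut n (t k) = truncate_aut n (g k) \<otimes>\<^bsub>Q\<^esub> truncate_aut n (s k) \<otimes>\<^bsub>Q\<^esub> inv\<^bsub>Q\<^esub> (truncate_aut n (g k))"
    if k: "k \<in> I" for k
  proof -
    have "truncate_aut n (t k) = truncate_aut n (tconj (g k) (s k))" using ag[OF k] by (simp add: truncate_aut_eq_iff)
    also have "\<dots> = truncate_aut n (g k) \<circ> truncate_aut n (s k) \<circ> truncate_aut n (tinv (g k))"
      using s[OF k] gA[OF k] by (simp add: tconj_def truncate_aut_comp)
    also have "truncate_aut n (tinv (g k)) = inv\<^bsub>level_group n\<^esub> (truncate_aut n (g k))"
      using gA[OF k] by (rule hom.hom_inv)
    also have "\<dots> = inv\<^bsub>Q\<^esub> (truncate_aut n (g k))"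
      unfolding Q_def using L.m_inv_consistent[OF H gH[OF k]] by simp
    finally show ?thesis by (simp only: mult_Q)
  qed
  have "generate Q ((\<lambda>k. truncate_aut n (t k)) ` I) = carrier Q"
  proof (rule Q.p_group_generate_conjugates[OF two_is_prime_nat ord _ _ _ tr])
    show "truncate_aut n (s k) \<in> carrier Q" "truncate_aut n (g k) \<in> carrier Q" if "k \<in> I" for k
      using sH gH that by (simp_all add: Q_def)
    have "generate Q ((\<lambda>k. truncate_aut n (s k)) ` I) = generate (level_group n) (truncate_aut n ` (s ` I))"
      using gen[of "(\<lambda>k. truncate_aut n (s k)) ` I"] sH by (simp add: image_image image_subset_iff)
    also have "\<dots> = H" unfolding H_def by (rule hom.generate_img[OF sI])
    finally show "generate Q ((\<lambda>k. truncate_aut n (s k)) ` I) = carrier Q" by (simp add: Q_def)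
  qed
  moreover have "truncate_aut n (t k) \<in> H" if "k \<in> I" for k
  proof -
    have "truncate_aut n (g k) \<in> carrier Q" "truncate_aut n (s k) \<in> carrier Q"
      using sH gH that by (simp_all add: Q_def)
    then have "truncate_aut n (t k) \<in> carrier Q" unfolding tr[OF that] by (intro Q.m_closed Q.inv_closed)
    then show ?thesis by (simp add: Q_def)
  qed
  then have "generate Q ((\<lambda>k. truncate_aut n (t k)) ` I) = generate (level_group n) (truncate_aut n ` (t ` I))"
    using gen[of "(\<lambda>k. truncate_aut n (t k)) ` I"] by (simp add: image_image image_subset_iff)
  moreover have "generate (level_group n) (truncate_aut n ` (t ` I)) = truncate_aut n ` generate tree_aut (t ` I)"
    by (rule hom.generate_img[OF tI])
  moreover have "carrier Q = H" by (simp add: Q_def)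
  moreover have "truncate_aut n y \<in> H" using y by (auto simp: H_def)
  ultimately have "truncate_aut n y \<in> truncate_aut n ` generate tree_aut (t ` I)" by metis
  then show ?thesis by (metis imageE truncate_aut_eq_iff)
qed

section \<open>The group of the standard generators\<close>

lemma case_sum_image_Plus: "case_sum f g ` (A <+> B) = f ` A \<union> g ` B"
  by (simp add: Plus_def image_Un image_image)

lemma tree_aut_subgroup_closed:
  assumes "subgroup H tree_aut"
  shows "id \<in> H" "f \<in> H \<Longrightarrow> g \<in> H \<Longrightarrow> f \<circ> g \<in> H" "f \<in> H \<Longrightarrow> tinv f \<in> H" "f \<in> H \<Longrightarrow> f \<in> AutT"
  using subgroup.one_closed[OF assms] subgroup.m_closed[OF assms] subgroup.m_inv_closed[OF assms]
    subgroup.mem_carrier[OF assms] by auto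

lemma closure_subgroup:
  assumes H: "subgroup H tree_aut"
  shows "subgroup (tree_aut_topology closure_of H) tree_aut"
proof -
  note iff = in_tree_aut_closure_iff[OF subgroup.subset[OF H]]
  note cl = tree_aut_subgroup_closed[OF H]
  show ?thesis
  proof (rule subgroup.intro)
    fix f g assume f: "f \<in> tree_aut_topology closure_of H" and g: "g \<in> tree_aut_topology closure_of H"
    have "\<exists>h\<in>H. agree_to_level n h (f \<circ> g)" for n
    proof -
      obtain f' g' where fg: "f' \<in> H" "agree_to_level n f' f" "g' \<in> H" "agree_to_level n g' g"
        using f g unfolding iff by blast
      then have "agree_to_level n (f' \<circ> g') (f \<circ> g)" using cl by (intro agree_comp)
      then show ?thesis using fg cl by blast
    qed
    then show "f \<otimes>\<^bsub>tree_aut\<^esub> g \<in> tree_aut_topology closure_of H" using f g by (simp add: iff)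
  next
    fix f assume f: "f \<in> tree_aut_topology closure_of H"
    have "\<exists>h\<in>H. agree_to_level n h (tinv f)" for n
    proof -
      obtain f' where fg: "f' \<in> H" "agree_to_level n f' f" using f unfolding iff by blast
      then have "agree_to_level n (tinv f') (tinv f)" using cl f iff by (intro agree_inv) auto
      then show ?thesis using fg cl by blast
    qed
    then show "tinv f \<in> tree_aut_topology closure_of H" using f by (simp add: iff)
  next
    show "\<one>\<^bsub>tree_aut\<^esub> \<in> tree_aut_topology closure_of H"
      unfolding iff tree_aut_simps using cl(1) agree_refl by blast
  qed (use iff in blast)
qed

locale std_gens =
  fixes r :: nat and a b :: "nat \<Rightarrow> vertex \<Rightarrow> vertex"
  assumes r: "r \<ge> 1" and std: "standard_generators r a b"
begin

lemma a_in [simp]: "i \<ge> 1 \<Longrightarrow> a i \<in> AutT"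
  and b_in [simp]: "1 \<le> j \<Longrightarrow> j \<le> r \<Longrightarrow> b j \<in> AutT"
  using std by (auto simp: standard_generators_def tree_aut_families_def)

lemma a_1: "a (Suc 0) = tree_swap"
  and a_Suc_r: "a (Suc r) = tree_pair (a r) (b r)"
  and a_Suc: "1 \<le> i \<Longrightarrow> i \<noteq> r \<Longrightarrow> a (Suc i) = tree_pair (a i) id"
  and b_1: "b (Suc 0) = tree_pair (b r) (tinv (b r)) \<circ> tree_swap"
  and b_Suc: "1 \<le> j \<Longrightarrow> j < r \<Longrightarrow> b (Suc j) = tree_pair (tconj (b r) (b j)) id"
proof -
  have A: "a i = recursion_a r a b i" if "i \<ge> 1" for i
    using std that unfolding standard_generators_iff_recursion[OF r] by blast
  have B: "b j = recursion_b r b j" if "1 \<le> j" "j \<le> r" for j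
    using std that unfolding standard_generators_iff_recursion[OF r] by simp
  have "recursion_a r a b (Suc 0) = tree_swap" by (simp add: recursion_a_def)
  then show "a (Suc 0) = tree_swap" by (rule trans[OF A, rotated]) simp
  have "recursion_a r a b (Suc r) = tree_pair (a r) (b r)" using r by (simp add: recursion_a_def)
  then show "a (Suc r) = tree_pair (a r) (b r)" by (rule trans[OF A, rotated]) simp
  have "recursion_b r b (Suc 0) = tree_pair (b r) (tinv (b r)) \<circ> tree_swap"
    by (simp only: recursion_b_def One_nat_def refl if_True tree_aut_simps)
  then show "b (Suc 0) = tree_pair (b r) (tinv (b r)) \<circ> tree_swap"
    by (rule trans[OF B, rotated 2]) (use r in simp_all)
  show "a (Suc i) = tree_pair (a i) id" if "1 \<le> i" "i \<noteq> r" for i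
  proof -
    have "Suc i \<noteq> 1" "Suc i \<noteq> r + 1" using that by auto
    then have "recursion_a r a b (Suc i) = tree_pair (a i) id"
      by (simp only: recursion_a_def if_False diff_Suc_1 tree_aut_simps)
    then show ?thesis by (rule trans[OF A, rotated]) simp
  qed
  show "b (Suc j) = tree_pair (tconj (b r) (b j)) id" if "1 \<le> j" "j < r" for j
  proof -
    have "Suc j \<noteq> 1" using that by auto
    then have "recursion_b r b (Suc j) = tree_pair (tconj (b r) (b j)) id"
      by (simp only: recursion_b_def if_False diff_Suc_1 tree_aut_simps tconj_def)
    then show ?thesis by (rule trans[OF B, rotated 2]) (use that in simp_all)
  qed
qed

lemma b_r_in: "b r \<in> AutT"
  using r by simp

text \<open>The square of \<open>b 1\<close> is trivial because its two components are inverse to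
  each other. Each later \<open>b j\<close> is a pair of a conjugate of its predecessor and the
  identity.\<close>

lemma b_involution:
  assumes "1 \<le> j" "j \<le> r" shows "b j \<circ> b j = id"
  using assms
proof (induction j rule: nat_induct_at_least)
  case base
  show ?case by (simp only: b_1 One_nat_def pair_swap_comps tinv_comp_cancel[OF b_r_in] tree_pair_id)
next
  case (Suc j)
  have "tconj (b r) (b j) \<circ> tconj (b r) (b j) = tconj (b r) (b j \<circ> b j)"
    by (simp only: tconj_comp[OF b_r_in])
  also have "\<dots> = id" using Suc by (simp only: Suc.IH Suc_leD tconj_id b_r_in)
  finally show ?case
    using Suc by (simp only: b_Suc Suc_le_eq pair_swap_comps id_comp tree_pair_id)
qed

lemma tinv_b_r: "tinv (b r) = b r"
  using b_involution[of r] r b_r_in by (intro tinv_unique(1)) auto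

text \<open>The swap in \<open>b 1\<close> gives the sign at the root, while its components have
  equal signs, which cancel. Each further step of the recursion moves the odd level down by
  one.\<close>

lemma parity_b:
  assumes "1 \<le> j" "j \<le> r" shows "parity m (b j) \<longleftrightarrow> Suc m = j"
  using assms
proof (induction j arbitrary: m rule: nat_induct_at_least)
  case base
  show ?case
  proof (cases m)
    case 0
    show ?thesis unfolding 0 One_nat_def b_1 using parity_pair_0(2)[OF b_r_in] by blast
  next
    case (Suc k)
    show ?thesis unfolding Suc One_nat_def b_1 parity_Suc_pair parity_tinv[OF b_r_in] by simp
  qed
next
  case (Suc j)
  have j: "1 \<le> j" "j < r" "j \<le> r" "b j \<in> AutT" using Suc by auto
  show ?case
  proof (cases m)
    case 0
    show ?thesis unfolding 0 b_Suc[OF j(1,2)] using parity_pair_0(1) j b_r_in by auto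
  next
    case (Suc k)
    have "parity k (tconj (b r) (b j)) \<longleftrightarrow> parity k (b j)"
      unfolding tconj_def using j b_r_in by auto
    then show ?thesis
      unfolding Suc b_Suc[OF j(1,2)] parity_Suc_pair using Suc.IH[OF j(3)] by simp
  qed
qed

text \<open>The single odd level moves down with the recursion up to \<open>a r\<close>. In
  \<open>a (Suc r)\<close> the signs of \<open>a r\<close> and \<open>b r\<close> cancel, and from
  there on all signs are trivial.\<close>

lemma parity_a:
  assumes "1 \<le> i" shows "parity m (a i) \<longleftrightarrow> Suc m = i \<and> i \<le> r"
  using assms
proof (induction i arbitrary: m rule: nat_induct_at_least)
  case base
  show ?case unfolding One_nat_def a_1 parity_swap_iff using r by auto
next
  case (Suc i)
  have i: "1 \<le> i" "a i \<in> AutT" using Suc by auto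
  show ?case
  proof (cases "i = r")
    case True
    show ?thesis
    proof (cases m)
      case 0
      show ?thesis unfolding 0 True a_Suc_r using parity_pair_0(1) i True by auto
    next
      case (Suc k)
      show ?thesis
        unfolding Suc True a_Suc_r parity_Suc_pair
        using Suc.IH True parity_b[of r k] r by auto
    qed
  next
    case False
    show ?thesis
    proof (cases m)
      case 0
      show ?thesis unfolding 0 a_Suc[OF i(1) False] using parity_pair_0(1) i by auto
    next
      case (Suc k)
      show ?thesis
        unfolding Suc a_Suc[OF i(1) False] parity_Suc_pair using Suc.IH False by auto
    qed
  qed
qed

definition \<Gamma> :: "(vertex \<Rightarrow> vertex) set" where
  "\<Gamma> = generate tree_aut (a ` {1..} \<union> b ` {1..r})"

definition G :: "(vertex \<Rightarrow> vertex) set" where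
  "G = closed_subgroup_gen r a b"

text \<open>Since \<open>parity m\<close> is the sign on level \<open>m + 1\<close>, the index
  \<open>r - 1\<close> gives the sign on level \<open>r\<close>.\<close>

definition \<rho> :: "(vertex \<Rightarrow> vertex) \<Rightarrow> bool" where
  "\<rho> f = parity (r - 1) f"

lemma \<rho>_comp: "f \<in> AutT \<Longrightarrow> g \<in> AutT \<Longrightarrow> \<rho> (f \<circ> g) \<longleftrightarrow> \<rho> f \<noteq> \<rho> g"
  and \<rho>_tinv: "f \<in> AutT \<Longrightarrow> \<rho> (tinv f) \<longleftrightarrow> \<rho> f"
  and \<rho>_id: "\<not> \<rho> id"
  and \<rho>_a: "1 \<le> i \<Longrightarrow> \<rho> (a i) \<longleftrightarrow> i = r"
  and \<rho>_b: "1 \<le> j \<Longrightarrow> j \<le> r \<Longrightarrow> \<rho> (b j) \<longleftrightarrow> j = r"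
  using r parity_a[of i "r - 1"] parity_b[of j "r - 1"]
  by (simp_all only: \<rho>_def parity_comp parity_tinv parity_id) auto

lemma gens_subset: "a ` {1..} \<union> b ` {1..r} \<subseteq> AutT"
  by auto

lemma \<Gamma>_subgroup: "subgroup \<Gamma> tree_aut"
  unfolding \<Gamma>_def by (rule group.generate_is_subgroup[OF tree_aut_group gens_subset])

lemma G_eq: "G = tree_aut_topology closure_of \<Gamma>"
  by (simp add: G_def \<Gamma>_def closed_subgroup_gen_def)

lemma G_subgroup: "subgroup G tree_aut"
  unfolding G_eq by (rule closure_subgroup[OF \<Gamma>_subgroup])

lemmas \<Gamma>_closed = tree_aut_subgroup_closed[OF \<Gamma>_subgroup]
lemmas G_closed = tree_aut_subgroup_closed[OF G_subgroup]

lemma G_iff: "g \<in> G \<longleftrightarrow> g \<in> AutT \<and> (\<forall>n. \<exists>h\<in>\<Gamma>. agree_to_level n h g)"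
  unfolding G_eq by (rule in_tree_aut_closure_iff[OF subgroup.subset[OF \<Gamma>_subgroup]])

lemma \<Gamma>_subset_G: "\<Gamma> \<subseteq> G"
proof
  fix g assume "g \<in> \<Gamma>"
  then show "g \<in> G" unfolding G_iff using \<Gamma>_closed(4) agree_refl by blast
qed

lemma a_in_\<Gamma>: "1 \<le> i \<Longrightarrow> a i \<in> \<Gamma>" and b_in_\<Gamma>: "1 \<le> j \<Longrightarrow> j \<le> r \<Longrightarrow> b j \<in> \<Gamma>"
  unfolding \<Gamma>_def by (auto intro: generate.incl)

lemma swap_in_\<Gamma>: "tree_swap \<in> \<Gamma>"
  using a_in_\<Gamma>[of "Suc 0"] by (simp only: a_1)

lemma pair_b_r_in_\<Gamma>: "tree_pair (b r) (b r) \<in> \<Gamma>"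
proof -
  have "b (Suc 0) \<circ> tree_swap \<in> \<Gamma>" using r by (intro \<Gamma>_closed swap_in_\<Gamma> b_in_\<Gamma>) auto
  then show ?thesis by (simp only: b_1 comp_assoc tree_swap_swap comp_id tinv_b_r)
qed

text \<open>For generators: a pair of \<open>a i\<close> with its compensating factor is
  \<open>a (Suc i)\<close>; the pair of \<open>b r\<close> with itself is \<open>b 1\<close> times
  the swap; and conjugating \<open>b (Suc j)\<close> by that pair gives the pair of
  \<open>b j\<close> and the identity. The general case follows since \<rho> is a homomorphism and
  \<open>b r\<close> is an involution.\<close>

lemma pair_compensated_in_\<Gamma>:
  assumes "g \<in> \<Gamma>" shows "tree_pair g (if \<rho> g then b r else id) \<in> \<Gamma>"
  using assms[unfolded \<Gamma>_def]
proof (induction rule: generate.induct)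
  \<comment> \<open>Proved before the case split because the cases of a generator and of the inverse
    of a generator both use it.\<close>
  have gen: "tree_pair h (if \<rho> h then b r else id) \<in> \<Gamma>" if h: "h \<in> a ` {1..} \<union> b ` {1..r}" for h
  proof -
    from h consider i where "1 \<le> i" "h = a i" | j where "1 \<le> j" "j \<le> r" "h = b j" by auto
    then show ?thesis
    proof cases
      case 1
      then show ?thesis
        using a_in_\<Gamma>[of "Suc i"] by (cases "i = r") (auto simp: \<rho>_a a_Suc a_Suc_r)
    next
      case 2
      show ?thesis
      proof (cases "j = r")
        case True
        then show ?thesis using 2 pair_b_r_in_\<Gamma> by (simp add: \<rho>_b)
      next
        case False
        then have "1 \<le> j" "j < r" using 2 by auto
        have "tconj (tree_pair (b r) (b r)) (b (Suc j)) \<in> \<Gamma>"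
          unfolding tconj_def using \<open>j < r\<close> by (intro \<Gamma>_closed pair_b_r_in_\<Gamma> b_in_\<Gamma>) auto
        also have "tconj (tree_pair (b r) (b r)) (b (Suc j))
            = tree_pair (tconj (b r) (tconj (b r) (b j))) (tconj (b r) id)"
          unfolding b_Suc[OF \<open>1 \<le> j\<close> \<open>j < r\<close>] by (rule tconj_pair[OF b_r_in b_r_in])
        also have "\<dots> = tree_pair (b j) id"
          using r b_involution[of r] by (simp only: tconj_tconj[OF b_r_in b_r_in] le_refl tconj_id b_r_in)
        finally show ?thesis using 2 False by (simp add: \<rho>_b)
      qed
    qed
  qed
  {
    case one
    show ?case unfolding tree_aut_simps if_not_P[OF \<rho>_id] tree_pair_id by (rule \<Gamma>_closed)
  next
    case (incl h)
    then show ?case by (rule gen)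
  next
    case (inv h)
    then have h: "h \<in> AutT" by auto
    have "tinv (tree_pair h (if \<rho> h then b r else id)) \<in> \<Gamma>" using gen[OF inv] by (rule \<Gamma>_closed)
    moreover have "(if \<rho> h then b r else id) \<in> AutT" using b_r_in by simp
    moreover have "tinv (if \<rho> h then b r else id) = (if \<rho> h then b r else id)"
      using tinv_b_r by simp
    ultimately show ?case by (simp only: tinv_pair[OF h] \<rho>_tinv[OF h])
  next
    case (eng g h)
    then have gh: "g \<in> AutT" "h \<in> AutT" using \<Gamma>_closed(4) unfolding \<Gamma>_def by blast+
    have "tree_pair g (if \<rho> g then b r else id) \<circ> tree_pair h (if \<rho> h then b r else id) \<in> \<Gamma>"
      using eng by (intro \<Gamma>_closed)
    moreover have "(if \<rho> g then b r else id) \<circ> (if \<rho> h then b r else id)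
        = (if \<rho> (g \<circ> h) then b r else id)"
      using \<rho>_comp[OF gh] b_involution[of r] r by simp
    ultimately show ?case by (simp only: tree_pair_comp tree_aut_simps)
  }
qed

text \<open>Conjugating by the swap moves the compensating factor to the first component. As both
  factors equal the same involution \<open>?c\<close>, they cancel in the product of
  \<open>(g, ?c)\<close>, \<open>(?c, ?c)\<close> and \<open>(?c, h)\<close>.\<close>

lemma pair_in_\<Gamma>:
  assumes "g \<in> \<Gamma>" "h \<in> \<Gamma>" "\<rho> g = \<rho> h" shows "tree_pair g h \<in> \<Gamma>"
proof -
  let ?c = "if \<rho> h then b r else id"
  have 1: "tree_pair g ?c \<in> \<Gamma>" using pair_compensated_in_\<Gamma>[OF assms(1)] assms(3) by simp
  have "tree_swap \<circ> tree_pair h ?c \<circ> tree_swap \<in> \<Gamma>"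
    by (intro \<Gamma>_closed swap_in_\<Gamma> pair_compensated_in_\<Gamma> assms)
  then have 2: "tree_pair ?c h \<in> \<Gamma>"
    by (simp only: swap_pair comp_assoc tree_swap_swap comp_id)
  have 3: "tree_pair ?c ?c \<in> \<Gamma>" using pair_b_r_in_\<Gamma> \<Gamma>_closed(1) by simp
  have c: "?c \<circ> ?c = id" using b_involution[of r] r by simp
  have "tree_pair g ?c \<circ> tree_pair ?c ?c \<circ> tree_pair ?c h \<in> \<Gamma>"
    by (intro \<Gamma>_closed 1 2 3)
  also have "tree_pair g ?c \<circ> tree_pair ?c ?c \<circ> tree_pair ?c h = tree_pair (g \<circ> (?c \<circ> ?c)) ((?c \<circ> ?c) \<circ> h)"
    by (simp only: tree_pair_comp comp_assoc)
  finally show ?thesis by (simp only: c comp_id id_comp)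
qed

lemma pair_in_G:
  assumes "g \<in> G" "h \<in> G" "\<rho> g = \<rho> h" shows "tree_pair g h \<in> G"
  unfolding G_iff
proof (intro conjI allI)
  have gh: "g \<in> AutT" "h \<in> AutT" using assms G_closed(4) by blast+
  then show "tree_pair g h \<in> AutT" by blast
  fix n
  \<comment> \<open>The precision \<open>n + r\<close> ensures that the approximations have the same
    sign on level \<open>r\<close> as \<open>g\<close> and \<open>h\<close>.\<close>
  obtain g' h' where g': "g' \<in> \<Gamma>" "agree_to_level (n + r) g' g" and h': "h' \<in> \<Gamma>" "agree_to_level (n + r) h' h"
    using assms unfolding G_iff by blast
  have "\<rho> g' = \<rho> g" "\<rho> h' = \<rho> h"
    unfolding \<rho>_def using r by (intro parity_agree[OF g'(2)] parity_agree[OF h'(2)]; simp)+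
  then have "tree_pair g' h' \<in> \<Gamma>" using assms g' h' by (intro pair_in_\<Gamma>) auto
  moreover have "agree_to_level n (tree_pair g' h') (tree_pair g h)"
    by (rule agree_mono[OF agree_pair[OF g'(2) h'(2)]]) simp
  ultimately show "\<exists>f\<in>\<Gamma>. agree_to_level n f (tree_pair g h)" by blast
qed

lemma swap_in_G: "tree_swap \<in> G" and a_in_G: "1 \<le> i \<Longrightarrow> a i \<in> G"
  and b_in_G: "1 \<le> j \<Longrightarrow> j \<le> r \<Longrightarrow> b j \<in> G"
  using \<Gamma>_subset_G swap_in_\<Gamma> a_in_\<Gamma> b_in_\<Gamma> by blast+

end

section \<open>Products and the recursion for the components\<close>

definition lprod :: "('a \<Rightarrow> 'a) list \<Rightarrow> 'a \<Rightarrow> 'a" where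
  "lprod fs = foldr (\<circ>) fs id"

lemma lprod_Nil: "lprod [] = id" and lprod_Cons: "lprod (f # fs) = f \<circ> lprod fs"
  by (simp_all add: lprod_def)

lemma lprod_append: "lprod (fs @ gs) = lprod fs \<circ> lprod gs"
  by (induction fs) (simp_all only: append.simps lprod_Nil lprod_Cons id_comp comp_assoc)

lemma lprod_in_subgroup:
  assumes "subgroup H tree_aut" "\<And>k. k \<in> set ks \<Longrightarrow> f k \<in> H"
  shows "lprod (map f ks) \<in> H"
  using assms(2)
proof (induction ks)
  case Nil
  show ?case unfolding list.map lprod_Nil by (rule tree_aut_subgroup_closed[OF assms(1)])
next
  case (Cons k ks)
  then have "f k \<in> H" "lprod (map f ks) \<in> H" by simp_all
  then show ?case unfolding list.map lprod_Cons by (rule tree_aut_subgroup_closed[OF assms(1)])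
qed

lemma aut_subgroup: "subgroup AutT tree_aut"
  by (rule group.subgroup_self[OF tree_aut_group])

lemmas lprod_closed = lprod_in_subgroup[OF aut_subgroup]

lemma lprod_pair:
  "lprod (map (\<lambda>k. tree_pair (x k) (y k)) ks) = tree_pair (lprod (map x ks)) (lprod (map y ks))"
  by (induction ks) (simp_all only: list.map lprod_Nil lprod_Cons tree_pair_id tree_pair_comp)

lemma lprod_tconj:
  assumes "h \<in> AutT"
  shows "lprod (map (\<lambda>k. tconj h (f k)) ks) = tconj h (lprod (map f ks))"
  by (induction ks) (simp_all only: list.map lprod_Nil lprod_Cons tconj_id(2)[OF assms] tconj_comp[OF assms])

lemma lprod_agree:
  assumes "\<And>k. k \<in> set ks \<Longrightarrow> f k \<in> AutT" "\<And>k. k \<in> set ks \<Longrightarrow> agree_to_level n (f k) (g k)"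
  shows "agree_to_level n (lprod (map f ks)) (lprod (map g ks))"
  using assms
proof (induction ks)
  case Nil
  show ?case unfolding list.map by (rule agree_refl)
next
  case (Cons k ks)
  then show ?case unfolding list.map lprod_Cons
    by (intro agree_comp lprod_closed) simp_all
qed

lemma lprod_filter:
  assumes "\<And>k. k \<in> set ks \<Longrightarrow> \<not> P k \<Longrightarrow> f k = id"
  shows "lprod (map f (filter P ks)) = lprod (map f ks)"
  using assms
proof (induction ks)
  case (Cons k ks)
  have "lprod (map f (filter P ks)) = lprod (map f ks)" by (rule Cons.IH) (rule Cons.prems, simp_all)
  moreover have "\<not> P k \<Longrightarrow> f k = id" by (rule Cons.prems) simp_all
  ultimately show ?case
    by (cases "P k") (simp_all only: filter.simps if_True if_False list.map lprod_Cons id_comp simp_thms)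
qed simp

text \<open>The factor with index \<open>z\<close> is the only odd one, and by distinctness it
  occurs at most once.\<close>

lemma parity_lprod_distinct:
  assumes "distinct ks" "\<And>k. k \<in> set ks \<Longrightarrow> f k \<in> AutT"
    and "\<And>k. k \<in> set ks \<Longrightarrow> parity m (f k) \<longleftrightarrow> k = z"
  shows "parity m (lprod (map f ks)) \<longleftrightarrow> z \<in> set ks"
  using assms
proof (induction ks)
  case Nil
  show ?case unfolding list.map lprod_Nil by (simp only: parity_id list.set empty_iff)
next
  case (Cons k ks)
  have f: "f k \<in> AutT" "lprod (map f ks) \<in> AutT"
    using Cons.prems(2) by (auto intro: lprod_closed)
  have "parity m (lprod (map f ks)) \<longleftrightarrow> z \<in> set ks"
    using Cons.prems by (intro Cons.IH) simp_all
  moreover have "parity m (f k) \<longleftrightarrow> k = z" using Cons.prems(3) by simp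
  ultimately show ?case
    unfolding list.map lprod_Cons parity_comp[OF f] using Cons.prems(1) by auto
qed

text \<open>\<open>Inl i\<close> and \<open>Inr j\<close> index the two lists of generators. In the
  recursion, the member with index \<open>p\<close> is conjugate to the pair whose first component
  has index \<open>pred_index p\<close> and whose second component is
  \<open>second_child r F p\<close>.\<close>

definition pred_index :: "nat + nat \<Rightarrow> nat + nat" where
  "pred_index = map_sum (\<lambda>i. i - 1) (\<lambda>j. j - 1)"

definition succ_index :: "nat + nat \<Rightarrow> nat + nat" where
  "succ_index = map_sum Suc Suc"

lemma pred_succ_index [simp]: "pred_index (succ_index k) = k"
  by (cases k) (simp_all add: pred_index_def succ_index_def)

definition second_child :: "nat \<Rightarrow> (nat + nat \<Rightarrow> vertex \<Rightarrow> vertex) \<Rightarrow> nat + nat \<Rightarrow> vertex \<Rightarrow> vertex" where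
  "second_child r F p = (if p = Inl (Suc r) then F (Inr r) else id)"

lemma second_child_simps:
  "second_child r F (Inl (Suc r)) = F (Inr r)"
  "p \<noteq> Inl (Suc r) \<Longrightarrow> second_child r F p = id"
  by (simp_all add: second_child_def)

definition all_indices :: "nat \<Rightarrow> (nat + nat) set" where
  "all_indices r = {1..} <+> {1..r}"

text \<open>Products at a finite level are taken over such a set, including members that act
  trivially there, so that the range of indices is independent of the family.\<close>

definition first_indices :: "nat \<Rightarrow> nat \<Rightarrow> (nat + nat) set" where
  "first_indices r N = {1..N} <+> {1..r}"

definition recursion_indices :: "nat \<Rightarrow> (nat + nat) set" where
  "recursion_indices r = all_indices r - {Inl 1, Inr 1}"

lemma index_iff [simp]:
  "Inl i \<in> all_indices r \<longleftrightarrow> 1 \<le> i" "Inr j \<in> all_indices r \<longleftrightarrow> 1 \<le> j \<and> j \<le> r"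
  "Inl i \<in> first_indices r N \<longleftrightarrow> 1 \<le> i \<and> i \<le> N" "Inr j \<in> first_indices r N \<longleftrightarrow> 1 \<le> j \<and> j \<le> r"
  "Inl i \<in> recursion_indices r \<longleftrightarrow> 2 \<le> i" "Inr j \<in> recursion_indices r \<longleftrightarrow> 2 \<le> j \<and> j \<le> r"
  by (auto simp: all_indices_def first_indices_def recursion_indices_def)

lemma recursion_indices_cases [consumes 1, case_names Inl Inr]:
  assumes "p \<in> recursion_indices r"
  obtains i where "p = Inl (Suc i)" "1 \<le> i" "pred_index p = Inl i"
  | j where "p = Inr (Suc j)" "1 \<le> j" "j < r" "pred_index p = Inr j"
proof (cases p)
  case (Inl i)
  then obtain i' where "i = Suc i'" "1 \<le> i'" using assms by (cases i) auto
  then show ?thesis using Inl that(1) by (simp add: pred_index_def)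
next
  case (Inr j)
  then obtain j' where "j = Suc j'" "1 \<le> j'" "j' < r" using assms by (cases j) auto
  then show ?thesis using Inr that(2) by (simp add: pred_index_def)
qed

section \<open>Families satisfying the recursion up to conjugacy, and their components\<close>

definition conjugate_recursion_family :: "nat \<Rightarrow> (nat + nat \<Rightarrow> vertex \<Rightarrow> vertex) \<Rightarrow> bool" where
  "conjugate_recursion_family r F \<longleftrightarrow> F (Inl 1) \<sim>\<^sub>W tree_swap \<and> F (Inr 1) \<sim>\<^sub>W tree_swap \<and>
     (\<forall>p\<in>recursion_indices r. F p \<sim>\<^sub>W tree_pair (F (pred_index p)) (second_child r F p))"

text \<open>Conjugating the components of a pair separately is conjugation of the pair by an element
  of \<open>W \<times> W\<close>, so every member may be replaced by a conjugate of its own.\<close>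

lemma conjugate_recursion_family_cong:
  assumes r: "r \<ge> 1" and F: "conjugate_recursion_family r F"
    and F': "\<And>k. k \<in> all_indices r \<Longrightarrow> F' k \<sim>\<^sub>W F k"
  shows "conjugate_recursion_family r F'"
  unfolding conjugate_recursion_family_def
proof (intro conjI ballI)
  show "F' (Inl 1) \<sim>\<^sub>W tree_swap" "F' (Inr 1) \<sim>\<^sub>W tree_swap"
    using F r by (auto simp: conjugate_recursion_family_def intro!: tree_conj_trans[OF F'])
  fix p assume p: "p \<in> recursion_indices r"
  have "F' p \<sim>\<^sub>W F p" using p by (intro F') (simp add: recursion_indices_def)
  moreover have "F p \<sim>\<^sub>W tree_pair (F (pred_index p)) (second_child r F p)"
    using F p by (simp add: conjugate_recursion_family_def)
  moreover have "F (pred_index p) \<sim>\<^sub>W F' (pred_index p)"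
    using p by (intro tree_conj_sym[OF F']) (auto elim: recursion_indices_cases)
  moreover have "second_child r F p \<sim>\<^sub>W second_child r F' p"
    unfolding second_child_def using r tree_conj_sym[OF F'] tree_conj_refl by simp
  ultimately show "F' p \<sim>\<^sub>W tree_pair (F' (pred_index p)) (second_child r F' p)"
    by (blast intro: tree_conj_trans tree_conj_pair)
qed

text \<open>A conjugator that is a pair conjugates the components; one that involves the swap also
  interchanges them, which the flag \<open>s\<close> records.\<close>

lemma conj_pair_split:
  assumes "f \<sim>\<^sub>W tree_pair x y" and xy: "x \<in> AutT" "y \<in> AutT"
  shows "\<exists>s u v. f = (if s then tree_pair v u else tree_pair u v) \<and> u \<sim>\<^sub>W x \<and> v \<sim>\<^sub>W y"
proof -
  obtain h where h: "h \<in> AutT" "f = tconj h (tree_pair x y)"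
    using assms unfolding conjugate_under_iff by blast
  have c: "tconj g z \<sim>\<^sub>W z" if "g \<in> AutT" for g z using that unfolding conjugate_under_iff by blast
  from h(1) show ?thesis
  proof (cases rule: aut_cases)
    case (pair g g')
    then have "f = tree_pair (tconj g x) (tconj g' y)" using h by (simp only: tconj_pair)
    then show ?thesis using c pair by (metis (full_types))
  next
    case (swapped g g')
    then have "f = tree_pair (tconj g y) (tconj g' x)"
      using h by (simp only: tconj_tconj[symmetric] tconj_swap_pair tconj_pair tree_pair_in tree_swap_in)
    then show ?thesis using c swapped by (metis (full_types))
  qed
qed

lemma conj_id_eq_id: "v \<sim>\<^sub>W id \<Longrightarrow> v = id"
  unfolding conjugate_under_iff using tconj_id(2) by blast

lemma tree_conj_closed: "v \<sim>\<^sub>W x \<Longrightarrow> x \<in> AutT \<Longrightarrow> v \<in> AutT"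
  unfolding conjugate_under_iff by blast

text \<open>Passing to the two subtrees: the components of the members of \<open>F\<close> other than the two
  involving the swap form a family \<open>F'\<close> of the same kind; \<open>s p\<close> tells on which side the first
  child of \<open>p\<close> sits.\<close>

lemma section_family:
  assumes r: "r \<ge> 1" and F: "\<And>k. k \<in> all_indices r \<Longrightarrow> F k \<in> AutT" and rec: "conjugate_recursion_family r F"
  obtains F' s where "\<And>k. k \<in> all_indices r \<Longrightarrow> F' k \<sim>\<^sub>W F k"
    and "\<And>p. p \<in> recursion_indices r \<Longrightarrow> F p =
      (if s p then tree_pair (second_child r F' p) (F' (pred_index p))
       else tree_pair (F' (pred_index p)) (second_child r F' p))"
proof -
  have "\<exists>s u v. F p = (if s then tree_pair v u else tree_pair u v) \<and> u \<sim>\<^sub>W F (pred_index p) \<and>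
      v \<sim>\<^sub>W second_child r F p" if p: "p \<in> recursion_indices r" for p
  proof (rule conj_pair_split)
    show "F p \<sim>\<^sub>W tree_pair (F (pred_index p)) (second_child r F p)"
      using rec p by (simp add: conjugate_recursion_family_def)
    show "F (pred_index p) \<in> AutT" using p by (intro F) (auto elim: recursion_indices_cases)
    show "second_child r F p \<in> AutT" using F[of "Inr r"] r by (simp add: second_child_def)
  qed
  then obtain s u v where suv: "\<And>p. p \<in> recursion_indices r \<Longrightarrow>
      F p = (if s p then tree_pair (v p) (u p) else tree_pair (u p) (v p)) \<and>
      u p \<sim>\<^sub>W F (pred_index p) \<and> v p \<sim>\<^sub>W second_child r F p"
    by metis
  \<comment> \<open>Every index except \<open>Inr r\<close> is that of the first child of its
    successor, and \<open>Inr r\<close> is that of the second child of \<open>Inl (Suc r)\<close>.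
    Hence each member of \<open>F'\<close> is read off from exactly one component.\<close>
  define F' where "F' k = (if k = Inr r then v (Inl (Suc r)) else u (succ_index k))" for k
  have 1: "F' (pred_index p) = u p" if "p \<in> recursion_indices r" for p
    using that by (cases rule: recursion_indices_cases) (auto simp: F'_def succ_index_def)
  have 2: "second_child r F' p = v p" if p: "p \<in> recursion_indices r" for p
  proof (cases "p = Inl (Suc r)")
    case True
    then show ?thesis by (simp add: second_child_def F'_def)
  next
    case False
    then have "v p \<sim>\<^sub>W id" using suv[OF p] unfolding second_child_simps(2)[OF False] by blast
    then show ?thesis unfolding second_child_simps(2)[OF False] by (rule sym[OF conj_id_eq_id])
  qed
  have 3: "F' k \<sim>\<^sub>W F k" if k: "k \<in> all_indices r" for k
  proof (cases "k = Inr r")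
    case True
    have "v (Inl (Suc r)) \<sim>\<^sub>W F (Inr r)"
      using suv[of "Inl (Suc r)"] r by (simp only: second_child_simps index_iff)
    then show ?thesis using True by (simp add: F'_def)
  next
    case False
    then have "succ_index k \<in> recursion_indices r"
      using k by (cases k) (auto simp: succ_index_def)
    then show ?thesis using suv[of "succ_index k"] False by (simp add: F'_def)
  qed
  have 4: "F p = (if s p then tree_pair (second_child r F' p) (F' (pred_index p))
       else tree_pair (F' (pred_index p)) (second_child r F' p))" if p: "p \<in> recursion_indices r" for p
    unfolding 1[OF p] 2[OF p] using suv[OF p] by blast
  show thesis by (rule that[OF 3 4])
qed

text \<open>Together the two factors run once through all components of the pairs. Each
  \<open>F k\<close> with \<open>k\<close> in \<open>first_indices r N\<close> is exactly one of
  these components and all others are trivial; deleting the trivial ones leaves a product of the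
  \<open>F k\<close> in some order.\<close>

lemma descend_product:
  assumes r: "r \<ge> 1" and N: "r \<le> N"
    and x: "\<And>p. p \<in> recursion_indices r \<Longrightarrow> x p = (if s p then second_child r F p else F (pred_index p))"
    and y: "\<And>p. p \<in> recursion_indices r \<Longrightarrow> y p = (if s p then F (pred_index p) else second_child r F p)"
    and M: "distinct M" "set M = first_indices r (Suc N) - {Inl 1, Inr 1}"
  obtains ks where "distinct ks" "set ks = first_indices r N"
    "lprod (map F ks) = lprod (map x M) \<circ> lprod (map y M)"
proof -
  \<comment> \<open>The position of \<open>F k\<close> among the components: the index of the pair,
    and the side, with \<open>True\<close> for the second subtree. The list \<open>L\<close>
    enumerates all positions in the order of the product.\<close>
  define \<psi> where "\<psi> k = (if k = Inr r then (Inl (Suc r), \<not> s (Inl (Suc r))) else (succ_index k, s (succ_index k)))" for k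
  define comp where "comp = (\<lambda>(p, t). if t then y p else x p)"
  define L where "L = map (\<lambda>p. (p, False)) M @ map (\<lambda>p. (p, True)) M"
  define I where "I = first_indices r N"
  have MR: "set M \<subseteq> recursion_indices r"
    unfolding M recursion_indices_def by (auto simp: first_indices_def all_indices_def)
  have "inj \<psi>"
  proof (rule injI)
    fix k l assume "\<psi> k = \<psi> l"
    then show "k = l" by (cases k; cases l) (auto simp: \<psi>_def succ_index_def split: if_splits)
  qed
  then have inj: "inj_on \<psi> I" by (rule inj_on_subset) simp
  have succ_in: "succ_index k \<in> set M" if "k \<in> I" "k \<noteq> Inr r" for k
    using that unfolding M I_def by (cases k) (auto simp: succ_index_def)
  \<comment> \<open>By \<open>r \<le> N\<close> the index \<open>r + 1\<close> is in range, so that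
    the component \<open>F (Inr r)\<close> does occur.\<close>
  have top_in: "Inl (Suc r) \<in> set M" unfolding M using r N by auto
  have \<psi>L: "\<psi> ` I \<subseteq> set L"
  proof
    fix q assume "q \<in> \<psi> ` I"
    then obtain k where k: "k \<in> I" "q = \<psi> k" by blast
    then have "fst q \<in> set M" using succ_in top_in by (auto simp: \<psi>_def)
    then show "q \<in> set L" unfolding L_def by (cases q; cases "snd q") auto
  qed
  have F_comp: "F k = comp (\<psi> k)" if k: "k \<in> I" for k
  proof (cases "k = Inr r")
    case True
    have "Inl (Suc r) \<in> recursion_indices r" using r by simp
    then show ?thesis
      using x[of "Inl (Suc r)"] y[of "Inl (Suc r)"] True by (simp add: \<psi>_def comp_def second_child_def)
  next
    case False
    then have "succ_index k \<in> recursion_indices r" using succ_in[OF k] MR by blast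
    then show ?thesis
      using x[of "succ_index k"] y[of "succ_index k"] False by (simp add: \<psi>_def comp_def)
  qed
  define ks where "ks = map (inv_into I \<psi>) (filter (\<lambda>q. q \<in> \<psi> ` I) L)"
  have "distinct L"
    using M(1) by (auto simp: L_def distinct_map inj_on_def)
  then have "distinct ks" by (auto simp: ks_def distinct_map intro!: inj_on_inv_into)
  moreover have "set ks = I"
  proof -
    have "set ks = inv_into I \<psi> ` (\<psi> ` I)" using \<psi>L by (auto simp: ks_def)
    then show ?thesis using inj by (simp add: inv_into_image_cancel)
  qed
  moreover have "lprod (map F ks) = lprod (map x M) \<circ> lprod (map y M)"
  proof -
    have "map F ks = map comp (filter (\<lambda>q. q \<in> \<psi> ` I) L)"
      unfolding ks_def map_map
    proof (rule map_cong[OF refl])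
      fix q assume "q \<in> set (filter (\<lambda>q. q \<in> \<psi> ` I) L)"
      then have q: "q \<in> \<psi> ` I" by simp
      have "(F \<circ> inv_into I \<psi>) q = F (inv_into I \<psi> q)" by simp
      also have "\<dots> = comp (\<psi> (inv_into I \<psi> q))" by (rule F_comp[OF inv_into_into[OF q]])
      also have "\<dots> = comp q" using q by (simp only: f_inv_into_f)
      finally show "(F \<circ> inv_into I \<psi>) q = comp q" .
    qed
    then have "lprod (map F ks) = lprod (map comp (filter (\<lambda>q. q \<in> \<psi> ` I) L))" by (rule arg_cong)
    also have "\<dots> = lprod (map comp L)"
    proof (rule lprod_filter)
      \<comment> \<open>A position missed by \<psi> is not that of a first child, nor that of the
        second child of \<open>Inl (Suc r)\<close>. It therefore carries a trivial second
        child.\<close>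
      fix q assume q: "q \<in> set L" "q \<notin> \<psi> ` I"
      obtain p t where pt: "q = (p, t)" by (cases q)
      have pM: "p \<in> set M" using q pt by (auto simp: L_def)
      then have p: "p \<in> recursion_indices r" using MR by blast
      have "(p, s p) = \<psi> (pred_index p)" "pred_index p \<in> I"
        using p pM unfolding M I_def
        by (auto elim!: recursion_indices_cases simp: \<psi>_def succ_index_def)
      then have "(p, s p) \<in> \<psi> ` I" by (rule image_eqI)
      then have t: "t \<noteq> s p" using q pt by auto
      have "(Inl (Suc r), \<not> s (Inl (Suc r))) = \<psi> (Inr r)" "Inr r \<in> I"
        using r by (simp_all add: \<psi>_def I_def)
      then have "(Inl (Suc r), \<not> s (Inl (Suc r))) \<in> \<psi> ` I" by (rule image_eqI)
      then have "p \<noteq> Inl (Suc r)" using q pt t by auto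
      then have "second_child r F p = id" by (rule second_child_simps)
      then show "comp q = id"
        using x[OF p] y[OF p] t by (cases t) (simp_all add: comp_def pt)
    qed
    also have "map comp L = map x M @ map y M" by (simp add: L_def comp_def)
    finally show ?thesis by (simp only: lprod_append)
  qed
  ultimately show thesis using that by (simp only: I_def)
qed

section \<open>Conjugation level by level\<close>

text \<open>Conjugating the swap by the pair of \<open>u\<close> and \<open>v\<close> gives the form
  with \<open>c = u \<circ> tinv v\<close>. A conjugator involving the swap gives nothing new, since
  the swap commutes with itself.\<close>

lemma conj_swap_form:
  assumes "f \<sim>\<^sub>W tree_swap"
  shows "\<exists>c\<in>AutT. f = tree_pair c (tinv c) \<circ> tree_swap"
proof -
  have *: "\<exists>c\<in>AutT. tconj (tree_pair u v) tree_swap = tree_pair c (tinv c) \<circ> tree_swap"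
    if "u \<in> AutT" "v \<in> AutT" for u v
  proof
    show "u \<circ> tinv v \<in> AutT" using that by blast
    have "tconj (tree_pair u v) tree_swap = tconj (tree_pair u v) (tree_pair id id \<circ> tree_swap)"
      by (simp only: tree_pair_id id_comp)
    also have "\<dots> = tree_pair (u \<circ> tinv v) (v \<circ> tinv u) \<circ> tree_swap"
      by (simp only: tconj_pair_swap[OF that] comp_id)
    also have "v \<circ> tinv u = tinv (u \<circ> tinv v)"
      using that by (simp only: tinv_comp tinv_closed tinv_tinv)
    finally show "tconj (tree_pair u v) tree_swap
        = tree_pair (u \<circ> tinv v) (tinv (u \<circ> tinv v)) \<circ> tree_swap" .
  qed
  obtain h where h: "h \<in> AutT" "f = tconj h tree_swap" using assms unfolding conjugate_under_iff by blast
  from h(1) show ?thesis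
  proof (cases rule: aut_cases)
    case (pair u v)
    then show ?thesis using * h by blast
  next
    case (swapped u v)
    have "tconj tree_swap tree_swap = tree_swap"
      by (simp only: tconj_def tinv_swap tree_swap_swap id_comp)
    then have "f = tconj (tree_pair u v) tree_swap"
      unfolding h(2) swapped(3) using swapped(1,2) by (simp only: tconj_tconj[symmetric] tree_pair_in tree_swap_in)
    then show ?thesis using *[OF swapped(1,2)] by (simp only:)
  qed
qed

text \<open>Cyclic rotation of a product is conjugation by its first factor, which preserves
  triviality at level \<open>n\<close>.\<close>

lemma agree_rotate:
  assumes "agree_to_level n (f \<circ> g) id" "f \<in> AutT" "g \<in> AutT"
  shows "agree_to_level n (g \<circ> f) id"
proof -
  have "agree_to_level n (tinv f \<circ> ((f \<circ> g) \<circ> f)) (tinv f \<circ> (id \<circ> f))"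
    using assms by (intro agree_comp agree_refl) auto
  moreover have "tinv f \<circ> ((f \<circ> g) \<circ> f) = g \<circ> f"
    using tinv_comp_cancel(1)[OF assms(2)] by (simp only: comp_assoc[symmetric] id_comp)
  ultimately show ?thesis
    using tinv_comp_cancel(1)[OF assms(2)] by (simp only: id_comp)
qed

lemma agree_solve_right:
  assumes "agree_to_level n (f \<circ> tinv g) id" "f \<in> AutT" "g \<in> AutT"
  shows "agree_to_level n g f"
proof -
  have "agree_to_level n ((f \<circ> tinv g) \<circ> g) (id \<circ> g)"
    using assms by (intro agree_comp agree_refl)
  then show ?thesis
    using tinv_comp_cancel(1)[OF assms(3)] by (simp only: comp_assoc comp_id id_comp) (rule agree_sym)
qed

section \<open>Conjugacy under \<open>G\<close> of pairs built from the standard generators\<close>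

context std_gens
begin

definition S :: "nat + nat \<Rightarrow> vertex \<Rightarrow> vertex" where
  "S = case_sum a b"

lemma S_in_G: "k \<in> all_indices r \<Longrightarrow> S k \<in> G"
  by (cases k) (auto simp: S_def intro: a_in_G b_in_G)

lemma S_in: "k \<in> all_indices r \<Longrightarrow> S k \<in> AutT"
  using S_in_G G_closed(4) by blast

lemma pred_index_in: "p \<in> recursion_indices r \<Longrightarrow> pred_index p \<in> all_indices r"
  by (cases rule: recursion_indices_cases) auto

lemma second_child_S_in_G: "second_child r S p \<in> G"
  unfolding second_child_def using S_in_G[of "Inr r"] r G_closed(1) by simp

text \<open>The odd generators are \<open>a r\<close> and \<open>b r\<close>. Since
  \<open>Inr r\<close> is not the \<open>pred_index\<close> of any recursion index, both occur as
  components only in \<open>a (Suc r)\<close>.\<close>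

lemma \<rho>_S:
  assumes "p \<in> recursion_indices r"
  shows "\<rho> (S (pred_index p)) \<longleftrightarrow> p = Inl (Suc r)" "\<rho> (second_child r S p) \<longleftrightarrow> p = Inl (Suc r)"
proof -
  show "\<rho> (S (pred_index p)) \<longleftrightarrow> p = Inl (Suc r)"
    using assms by (cases rule: recursion_indices_cases) (auto simp: S_def \<rho>_a \<rho>_b)
  show "\<rho> (second_child r S p) \<longleftrightarrow> p = Inl (Suc r)"
  proof (cases "p = Inl (Suc r)")
    case True
    then show ?thesis using \<rho>_b[of r] r by (simp add: second_child_def S_def)
  next
    case False
    then show ?thesis unfolding second_child_simps(2)[OF False] using \<rho>_id by blast
  qed
qed

text \<open>For the first list this is the recursion itself. For the second, the extra conjugation
  by \<open>b r\<close> in the recursion is undone by the pair of \<open>b r\<close> with itself,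
  which lies in \<open>G\<close>.\<close>

lemma pair_eq_conj_S:
  assumes "p \<in> recursion_indices r"
  shows "\<exists>h\<in>G. tree_pair (S (pred_index p)) (second_child r S p) = tconj h (S p)"
  using assms
proof (cases rule: recursion_indices_cases)
  case (Inl i)
  have "tree_pair (S (pred_index p)) (second_child r S p) = S p"
  proof (cases "i = r")
    case True
    then show ?thesis unfolding Inl(3) unfolding Inl(1) by (simp add: second_child_def S_def a_Suc_r)
  next
    case False
    then have "p \<noteq> Inl (Suc r)" using Inl by simp
    show ?thesis unfolding second_child_simps(2)[OF \<open>p \<noteq> _\<close>]
      unfolding Inl(3) unfolding Inl(1) S_def sum.case by (rule a_Suc[OF Inl(2) False, symmetric])
  qed
  then show ?thesis using G_closed(1) by (intro bexI[of _ id]) (simp_all only: tconj_id)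
next
  case (Inr j)
  have b: "tree_pair (b r) (b r) \<in> G" using pair_b_r_in_\<Gamma> \<Gamma>_subset_G by blast
  have "p \<noteq> Inl (Suc r)" using Inr by simp
  have "tconj (tree_pair (b r) (b r)) (S p) = tree_pair (tconj (b r) (tconj (b r) (b j))) (tconj (b r) id)"
    unfolding Inr S_def sum.case b_Suc[OF Inr(2,3)] by (rule tconj_pair[OF b_r_in b_r_in])
  also have "\<dots> = tree_pair (b j) id"
    using r b_involution[of r] by (simp only: tconj_tconj[OF b_r_in b_r_in] le_refl tconj_id b_r_in)
  also have "\<dots> = tree_pair (S (pred_index p)) (second_child r S p)"
    unfolding second_child_simps(2)[OF \<open>p \<noteq> _\<close>] unfolding Inr(4) S_def sum.case by (rule refl)
  finally have "tconj (tree_pair (b r) (b r)) (S p) = tree_pair (S (pred_index p)) (second_child r S p)" .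
  then show ?thesis by (intro bexI[OF _ b]) (rule sym)
qed

text \<open>If \<open>g\<close> and \<open>h\<close> have different parity, then either the second child is trivial, or it is \<open>b\<^sub>r\<close>
  and \<open>h\<close> may be replaced by \<open>h b\<^sub>r\<close>.\<close>

lemma pair_of_conjugates:
  assumes p: "p \<in> recursion_indices r" and g: "g \<in> G" and h: "h \<in> G"
  shows "\<exists>f\<in>G. tree_pair (tconj g (S (pred_index p))) (tconj h (second_child r S p)) = tconj f (S p)"
proof -
  have gA: "g \<in> AutT" and hA: "h \<in> AutT" using g h G_closed(4) by blast+
  obtain h' where h': "h' \<in> G" "\<rho> h' = \<rho> g" "tconj h' (second_child r S p) = tconj h (second_child r S p)"
  proof (cases "p = Inl (Suc r)")
    case True
    show thesis
    proof (cases "\<rho> h = \<rho> g")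
      case False
      have "tconj (b r) (b r) = b r" unfolding tconj_def tinv_b_r
        using b_involution[of r] r by (simp only: le_refl id_comp)
      then have "tconj (h \<circ> b r) (b r) = tconj h (b r)"
        by (simp only: tconj_tconj[OF hA b_r_in, symmetric])
      then have "tconj (h \<circ> b r) (second_child r S p) = tconj h (second_child r S p)"
        unfolding True second_child_simps(1) S_def sum.case .
      moreover have "\<rho> (h \<circ> b r) = \<rho> g"
        using False \<rho>_comp[OF hA b_r_in] \<rho>_b[of r] r by simp
      ultimately show thesis using that[of "h \<circ> b r"] h b_in_G[of r] r G_closed(2) by simp
    qed (use that h in blast)
  next
    case False
    show thesis
      by (rule that[OF g refl]) (simp only: second_child_simps(2)[OF False] tconj_id(2)[OF gA] tconj_id(2)[OF hA])
  qed
  have h'A: "h' \<in> AutT" using h' G_closed(4) by blast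
  obtain f where f: "f \<in> G" "tree_pair (S (pred_index p)) (second_child r S p) = tconj f (S p)"
    using pair_eq_conj_S[OF p] by blast
  have gh: "tree_pair g h' \<in> G" using g h' by (intro pair_in_G) auto
  have "tree_pair (tconj g (S (pred_index p))) (tconj h (second_child r S p))
      = tconj (tree_pair g h') (tconj f (S p))"
    unfolding f(2)[symmetric] tconj_pair[OF gA h'A] h'(3) ..
  also have "\<dots> = tconj (tree_pair g h' \<circ> f) (S p)"
    using gA h'A f G_closed(4) by (intro tconj_tconj) auto
  finally show ?thesis using G_closed(2)[OF gh f(1)] by blast
qed

text \<open>As \<open>b r\<close> is an involution, conjugating \<open>b 1\<close> by the pair of
  \<open>\<gamma> \<circ> b r\<close> and the identity yields the required element. This pair lies
  in \<open>G\<close> because \<gamma> and \<open>b r\<close> are both odd, so that their product is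
  even.\<close>

lemma swapped_conj_b_1:
  assumes "\<gamma> \<in> G" "\<rho> \<gamma>"
  shows "\<exists>f\<in>G. tree_pair \<gamma> (tinv \<gamma>) \<circ> tree_swap = tconj f (S (Inr 1))"
proof -
  have \<gamma>: "\<gamma> \<in> AutT" using assms G_closed(4) by blast
  have bG: "b r \<in> G" using b_in_G[of r] r by simp
  have g: "\<gamma> \<circ> b r \<in> G" using assms bG by (intro G_closed)
  have gA: "\<gamma> \<circ> b r \<in> AutT" using \<gamma> b_r_in by blast
  have "\<not> \<rho> (\<gamma> \<circ> b r)" using \<rho>_comp[OF \<gamma> b_r_in] assms \<rho>_b[of r] r by simp
  then have f: "tree_pair (\<gamma> \<circ> b r) id \<in> G" using g G_closed(1) \<rho>_id by (intro pair_in_G) auto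
  have "tconj (tree_pair (\<gamma> \<circ> b r) id) (S (Inr 1))
      = tree_pair ((\<gamma> \<circ> b r) \<circ> b r \<circ> tinv id) (id \<circ> b r \<circ> tinv (\<gamma> \<circ> b r)) \<circ> tree_swap"
    unfolding S_def sum.case One_nat_def b_1 tinv_b_r by (rule tconj_pair_swap[OF gA id_closed])
  also have "(\<gamma> \<circ> b r) \<circ> b r \<circ> tinv id = \<gamma>"
    using b_involution[of r] r by (simp only: comp_assoc le_refl comp_id tinv_id)
  also have "id \<circ> b r \<circ> tinv (\<gamma> \<circ> b r) = tinv \<gamma>"
    using b_involution[of r] r
    by (simp only: tinv_comp[OF \<gamma> b_r_in] tinv_b_r id_comp comp_assoc[symmetric] le_refl)
  finally have "tconj (tree_pair (\<gamma> \<circ> b r) id) (S (Inr 1)) = tree_pair \<gamma> (tinv \<gamma>) \<circ> tree_swap" .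
  then show ?thesis by (intro bexI[OF _ f]) (rule sym)
qed

end

section \<open>The step from level \<open>n\<close> to level \<open>n + 1\<close>\<close>

context std_gens
begin

text \<open>The conjugator \<open>w\<close> is common to all members, whereas \<open>g\<close> may
  depend on \<open>k\<close>; both may depend on \<open>n\<close>.\<close>

definition conjugate_to_level :: "nat \<Rightarrow> (nat + nat \<Rightarrow> vertex \<Rightarrow> vertex) \<Rightarrow> (vertex \<Rightarrow> vertex) \<Rightarrow> bool" where
  "conjugate_to_level n F w \<longleftrightarrow>
     w \<in> AutT \<and> (\<forall>k\<in>all_indices r. \<exists>g\<in>G. agree_to_level n (F k) (tconj w (tconj g (S k))))"

text \<open>The relation for \<open>F\<close> at level \<open>n + 1\<close> yields one for its
  components at level \<open>n\<close>, with index bound \<open>N\<close> instead of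
  \<open>Suc N\<close>; this is where \<open>IH\<close> applies. If \<open>w\<close> serves for the
  components, the pair of \<open>w\<close> with itself serves for \<open>F\<close>.\<close>

lemma level_step:
  assumes F: "\<And>k. k \<in> all_indices r \<Longrightarrow> F k \<in> AutT" and rec: "conjugate_recursion_family r F"
    and F1: "F (Inl 1) = tree_swap" and N: "r \<le> N"
    and ks: "distinct ks" "set ks = first_indices r (Suc N)"
    and prod: "agree_to_level (Suc n) (lprod (map F ks)) id"
    and IH: "\<And>F ks. (\<And>k. k \<in> all_indices r \<Longrightarrow> F k \<in> AutT) \<Longrightarrow> conjugate_recursion_family r F \<Longrightarrow>
       distinct ks \<Longrightarrow> set ks = first_indices r N \<Longrightarrow> agree_to_level n (lprod (map F ks)) id \<Longrightarrow>
       \<exists>w. conjugate_to_level n F w"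
  shows "\<exists>w. conjugate_to_level (Suc n) F w"
proof -
  obtain F' s where F'F: "\<And>k. k \<in> all_indices r \<Longrightarrow> F' k \<sim>\<^sub>W F k"
    and Fp: "\<And>p. p \<in> recursion_indices r \<Longrightarrow> F p =
      (if s p then tree_pair (second_child r F' p) (F' (pred_index p))
       else tree_pair (F' (pred_index p)) (second_child r F' p))"
    using section_family[OF r F rec] by blast
  have F': "F' k \<in> AutT" if "k \<in> all_indices r" for k
    using tree_conj_closed[OF F'F F] that by blast
  have rec': "conjugate_recursion_family r F'"
    by (rule conjugate_recursion_family_cong[OF r rec F'F])
  have F'2: "second_child r F' p \<in> AutT" for p
    using F'[of "Inr r"] r by (simp add: second_child_def)
  \<comment> \<open>\<open>x p\<close> and \<open>y p\<close> are the actions of \<open>F p\<close>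
    on the first and on the second subtree.\<close>
  define x where "x p = (if s p then second_child r F' p else F' (pred_index p))" for p
  define y where "y p = (if s p then F' (pred_index p) else second_child r F' p)" for p
  have Fxy: "F p = tree_pair (x p) (y p)" if "p \<in> recursion_indices r" for p
    using Fp[OF that] by (simp only: x_def y_def split: if_split) blast
  have xA: "x p \<in> AutT" and yA: "y p \<in> AutT" if "p \<in> recursion_indices r" for p
    using F'[OF pred_index_in[OF that]] F'2 by (simp_all add: x_def y_def)
  have "F (Inr 1) \<sim>\<^sub>W tree_swap" using rec unfolding conjugate_recursion_family_def by blast
  then obtain c where c: "c \<in> AutT" "F (Inr 1) = tree_pair c (tinv c) \<circ> tree_swap"
    using conj_swap_form by blast
  have "Inl 1 \<in> set ks" using ks by simp
  \<comment> \<open>The product is to be rotated so that the swap \<open>F (Inl 1)\<close> comes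
    first; \<open>P\<close> and \<open>Q\<close> below are then the stretches before and after
    \<open>F (Inr 1)\<close>.\<close>
  then obtain X Y where XY: "ks = X @ Inl 1 # Y" by (meson split_list)
  have "Inr 1 \<in> set ks" using ks r by simp
  then have "Inr 1 \<in> set (Y @ X)" unfolding XY by auto
  then obtain P Q where PQ: "Y @ X = P @ Inr 1 # Q" by (meson split_list)
  have dist: "distinct (Inl 1 # Y @ X)" using ks(1) unfolding XY by auto
  have sets: "set (Inl 1 # Y @ X) = first_indices r (Suc N)" using ks(2) unfolding XY by auto
  have M: "distinct (P @ Q)" "set (P @ Q) = first_indices r (Suc N) - {Inl 1, Inr 1}"
    using dist sets unfolding PQ by auto
  have MR: "set (P @ Q) \<subseteq> recursion_indices r"
    unfolding M recursion_indices_def by (auto simp: first_indices_def all_indices_def)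
  then have PR: "p \<in> recursion_indices r" if "p \<in> set P" for p using that by auto
  have QR: "p \<in> recursion_indices r" if "p \<in> set Q" for p using that MR by auto
  define p0 where "p0 = lprod (map x P)"
  define p1 where "p1 = lprod (map y P)"
  define q0 where "q0 = lprod (map x Q)"
  define q1 where "q1 = lprod (map y Q)"
  have in_A: "p0 \<in> AutT" "p1 \<in> AutT" "q0 \<in> AutT" "q1 \<in> AutT" "tinv c \<in> AutT"
    unfolding p0_def p1_def q0_def q1_def
    using xA yA PR QR c by (auto intro!: lprod_closed)
  have "map F P = map (\<lambda>p. tree_pair (x p) (y p)) P" using Fxy PR by (intro map_cong) auto
  then have prodP: "lprod (map F P) = tree_pair p0 p1" unfolding p0_def p1_def by (simp only: lprod_pair)
  have "map F Q = map (\<lambda>p. tree_pair (x p) (y p)) Q" using Fxy QR by (intro map_cong) auto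
  then have prodQ: "lprod (map F Q) = tree_pair q0 q1" unfolding q0_def q1_def by (simp only: lprod_pair)
  have ksA: "F k \<in> AutT" if "k \<in> set ks" for k
    using that ks(2) by (intro F) (auto simp: first_indices_def all_indices_def)
  have "agree_to_level (Suc n) (lprod (map F X) \<circ> lprod (map F (Inl 1 # Y))) id"
    using prod unfolding XY map_append lprod_append .
  then have "agree_to_level (Suc n) (lprod (map F (Inl 1 # Y)) \<circ> lprod (map F X)) id"
    by (rule agree_rotate) (rule lprod_closed, rule ksA, force simp: XY)+
  also have "lprod (map F (Inl 1 # Y)) \<circ> lprod (map F X) = lprod (map F (Inl 1 # (Y @ X)))"
    by (simp only: map_append lprod_append append_Cons flip: append_Cons)
  also have "\<dots> = tree_swap \<circ> (tree_pair p0 p1 \<circ> ((tree_pair c (tinv c) \<circ> tree_swap) \<circ> tree_pair q0 q1))"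
    unfolding PQ list.map map_append lprod_Cons lprod_append F1 c(2) prodP prodQ ..
  also have "\<dots> = tree_swap \<circ> (tree_pair (p0 \<circ> (c \<circ> q1)) (p1 \<circ> (tinv c \<circ> q0)) \<circ> tree_swap)"
    by (simp only: pair_swap_comps)
  also have "\<dots> = tree_pair (p1 \<circ> (tinv c \<circ> q0)) (p0 \<circ> (c \<circ> q1)) \<circ> (tree_swap \<circ> tree_swap)"
    unfolding comp_assoc[symmetric] swap_pair ..
  finally have "agree_to_level (Suc n) (tree_pair (p1 \<circ> (tinv c \<circ> q0)) (p0 \<circ> (c \<circ> q1))) (tree_pair id id)"
    by (simp only: tree_swap_swap comp_id tree_pair_id)
  \<comment> \<open>The two swaps have cancelled, so the relation is one between pairs and can be
    read in each subtree, one level less deep.\<close>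
  then have 1: "agree_to_level n (p1 \<circ> (tinv c \<circ> q0)) id" and 2: "agree_to_level n (p0 \<circ> (c \<circ> q1)) id"
    by (simp_all only: agree_pair_iff)
  have "agree_to_level n ((p1 \<circ> tinv c) \<circ> q0) id" using 1 by (simp only: comp_assoc)
  then have "agree_to_level n (q0 \<circ> (p1 \<circ> tinv c)) id" by (rule agree_rotate) (use in_A in blast)+
  then have "agree_to_level n ((q0 \<circ> p1) \<circ> tinv c) id" by (simp only: comp_assoc)
  \<comment> \<open>One of the two relations determines \<open>c\<close> to level \<open>n\<close>.
    Substituting this into the other leaves a relation among the components alone.\<close>
  then have c_qp: "agree_to_level n c (q0 \<circ> p1)" by (rule agree_solve_right) (use in_A c in blast)+
  then have "agree_to_level n (p0 \<circ> ((q0 \<circ> p1) \<circ> q1)) (p0 \<circ> (c \<circ> q1))"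
    using in_A c by (intro agree_comp agree_refl agree_sym[OF c_qp]) blast+
  then have "agree_to_level n (p0 \<circ> ((q0 \<circ> p1) \<circ> q1)) id" using 2 by (rule agree_trans)
  then have 3: "agree_to_level n (lprod (map x (P @ Q)) \<circ> lprod (map y (P @ Q))) id"
    unfolding map_append lprod_append p0_def p1_def q0_def q1_def comp_assoc .
  obtain ks' where ks': "distinct ks'" "set ks' = first_indices r N"
    "lprod (map F' ks') = lprod (map x (P @ Q)) \<circ> lprod (map y (P @ Q))"
    by (rule descend_product[where s = s and x = x and y = y and F = F' and M = "P @ Q", OF r N _ _ M])
      (simp_all only: x_def y_def)
  obtain w where "conjugate_to_level n F' w"
    using IH[OF F' rec' ks'(1,2)] 3 unfolding ks'(3) by blast
  then have w: "w \<in> AutT" and "\<forall>k\<in>all_indices r. \<exists>g\<in>G. agree_to_level n (F' k) (tconj w (tconj g (S k)))"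
    unfolding conjugate_to_level_def by blast+
  then obtain g where g: "\<And>k. k \<in> all_indices r \<Longrightarrow> g k \<in> G"
    and F'g: "\<And>k. k \<in> all_indices r \<Longrightarrow> agree_to_level n (F' k) (tconj w (tconj (g k) (S k)))"
    by metis
  have gA: "g k \<in> AutT" if "k \<in> all_indices r" for k using g[OF that] G_closed(4) by blast
  have rK: "Inr r \<in> all_indices r" using r by simp
  \<comment> \<open>\<open>e1 p\<close> and \<open>e2 p\<close> are elements of \<open>G\<close>
    that, conjugated by \<open>w\<close>, agree to level \<open>n\<close> with the first and second
    child of \<open>F p\<close>; \<open>ex\<close> and \<open>ey\<close> sort them by
    subtree.\<close>
  define e1 where "e1 p = tconj (g (pred_index p)) (S (pred_index p))" for p
  define e2 where "e2 p = tconj (g (Inr r)) (second_child r S p)" for p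
  have e1: "e1 p \<in> G" "\<rho> (e1 p) \<longleftrightarrow> p = Inl (Suc r)" "agree_to_level n (F' (pred_index p)) (tconj w (e1 p))"
    if p: "p \<in> recursion_indices r" for p
  proof -
    note k = pred_index_in[OF p]
    show "e1 p \<in> G" unfolding e1_def tconj_def using g[OF k] S_in_G[OF k] by (intro G_closed)
    show "\<rho> (e1 p) \<longleftrightarrow> p = Inl (Suc r)" unfolding e1_def tconj_def
      using \<rho>_S(1)[OF p] gA[OF k] S_in[OF k] by (auto simp: \<rho>_comp \<rho>_tinv)
    show "agree_to_level n (F' (pred_index p)) (tconj w (e1 p))" unfolding e1_def by (rule F'g[OF k])
  qed
  have S2: "second_child r S p \<in> AutT" for p using second_child_S_in_G G_closed(4) by blast
  have e2: "e2 p \<in> G" "\<rho> (e2 p) \<longleftrightarrow> p = Inl (Suc r)" "agree_to_level n (second_child r F' p) (tconj w (e2 p))"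
    if p: "p \<in> recursion_indices r" for p
  proof -
    show "e2 p \<in> G" unfolding e2_def tconj_def using g[OF rK] second_child_S_in_G by (intro G_closed)
    show "\<rho> (e2 p) \<longleftrightarrow> p = Inl (Suc r)" unfolding e2_def tconj_def
      using \<rho>_S(2)[OF p] gA[OF rK] S2 by (auto simp: \<rho>_comp \<rho>_tinv)
    show "agree_to_level n (second_child r F' p) (tconj w (e2 p))"
    proof (cases "p = Inl (Suc r)")
      case True
      show ?thesis unfolding e2_def True second_child_simps(1) by (rule F'g[OF rK])
    next
      case False
      show ?thesis unfolding e2_def second_child_simps(2)[OF False] tconj_id(2)[OF gA[OF rK]] tconj_id(2)[OF w]
        by (rule agree_refl)
    qed
  qed
  define ex where "ex p = (if s p then e2 p else e1 p)" for p
  define ey where "ey p = (if s p then e1 p else e2 p)" for p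
  have ex: "ex p \<in> G" "\<rho> (ex p) \<longleftrightarrow> p = Inl (Suc r)" "agree_to_level n (x p) (tconj w (ex p))"
    and ey: "ey p \<in> G" "\<rho> (ey p) \<longleftrightarrow> p = Inl (Suc r)" "agree_to_level n (y p) (tconj w (ey p))"
    if p: "p \<in> recursion_indices r" for p
    using e1[OF p] e2[OF p] by (auto simp only: ex_def ey_def x_def y_def split: if_split)
  \<comment> \<open>The counterparts in \<open>G\<close> of \<open>q0\<close> and \<open>p1\<close>.
    To level \<open>n\<close>, conjugating \<open>\<gamma>0 \<circ> \<gamma>1\<close> by
    \<open>w\<close> gives \<open>c\<close>.\<close>
  define \<gamma>0 where "\<gamma>0 = lprod (map ex Q)"
  define \<gamma>1 where "\<gamma>1 = lprod (map ey P)"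
  have \<gamma>G: "\<gamma>0 \<in> G" "\<gamma>1 \<in> G"
    unfolding \<gamma>0_def \<gamma>1_def using ex(1) ey(1) PR QR by (auto intro!: lprod_in_subgroup[OF G_subgroup])
  then have \<gamma>A: "\<gamma>0 \<in> AutT" "\<gamma>1 \<in> AutT" using G_closed(4) by blast+
  have "\<rho> \<gamma>0 \<longleftrightarrow> Inl (Suc r) \<in> set Q"
    unfolding \<gamma>0_def \<rho>_def
  proof (rule parity_lprod_distinct)
    show "distinct Q" using M by simp
    show "ex k \<in> AutT" if "k \<in> set Q" for k using ex(1)[OF QR[OF that]] G_closed(4) by blast
    show "parity (r - 1) (ex k) \<longleftrightarrow> k = Inl (Suc r)" if "k \<in> set Q" for k
      using ex(2)[OF QR[OF that]] unfolding \<rho>_def .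
  qed
  moreover have "\<rho> \<gamma>1 \<longleftrightarrow> Inl (Suc r) \<in> set P"
    unfolding \<gamma>1_def \<rho>_def
  proof (rule parity_lprod_distinct)
    show "distinct P" using M by simp
    show "ey k \<in> AutT" if "k \<in> set P" for k using ey(1)[OF PR[OF that]] G_closed(4) by blast
    show "parity (r - 1) (ey k) \<longleftrightarrow> k = Inl (Suc r)" if "k \<in> set P" for k
      using ey(2)[OF PR[OF that]] unfolding \<rho>_def .
  qed
  moreover have "Inl (Suc r) \<in> set (P @ Q)" unfolding M using r N by auto
  \<comment> \<open>The index \<open>Inl (Suc r)\<close> lies in exactly one of the disjoint lists
    \<open>P\<close> and \<open>Q\<close>, so exactly one of the two factors is odd.\<close>
  ultimately have \<rho>\<gamma>: "\<rho> (\<gamma>0 \<circ> \<gamma>1)" using M(1) \<rho>_comp[OF \<gamma>A] by auto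
  have "agree_to_level n q0 (lprod (map (\<lambda>p. tconj w (ex p)) Q))"
    unfolding q0_def using xA ex(3) QR by (intro lprod_agree) auto
  then have aq: "agree_to_level n q0 (tconj w \<gamma>0)" unfolding \<gamma>0_def lprod_tconj[OF w] .
  have "agree_to_level n p1 (lprod (map (\<lambda>p. tconj w (ey p)) P))"
    unfolding p1_def using yA ey(3) PR by (intro lprod_agree) auto
  then have ap: "agree_to_level n p1 (tconj w \<gamma>1)" unfolding \<gamma>1_def lprod_tconj[OF w] .
  have "agree_to_level n (q0 \<circ> p1) (tconj w \<gamma>0 \<circ> tconj w \<gamma>1)"
    using aq ap in_A by (intro agree_comp)
  then have "agree_to_level n (q0 \<circ> p1) (tconj w (\<gamma>0 \<circ> \<gamma>1))" by (simp only: tconj_comp[OF w])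
  with c_qp have c\<gamma>: "agree_to_level n c (tconj w (\<gamma>0 \<circ> \<gamma>1))" by (rule agree_trans)
  define \<gamma> where "\<gamma> = \<gamma>0 \<circ> \<gamma>1"
  have \<gamma>: "\<gamma> \<in> G" "\<gamma> \<in> AutT" "\<rho> \<gamma>" unfolding \<gamma>_def using \<gamma>G \<rho>\<gamma> G_closed by blast+
  \<comment> \<open>The same conjugator on both subtrees commutes with the swap, so
    \<open>F (Inl 1)\<close> remains the swap.\<close>
  define ww where "ww = tree_pair w w"
  have ww: "ww \<in> AutT" unfolding ww_def using w by blast
  have "\<exists>f\<in>G. agree_to_level (Suc n) (F k) (tconj ww (tconj f (S k)))" if k: "k \<in> all_indices r" for k
  proof -
    consider "k = Inl 1" | "k = Inr 1" | "k \<in> recursion_indices r"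
      using k by (auto simp: recursion_indices_def)
    then show ?thesis
    proof cases
      case 1
      have "tconj ww tree_swap = tconj ww (tree_pair id id \<circ> tree_swap)" by (simp only: tree_pair_id id_comp)
      also have "\<dots> = tree_pair id id \<circ> tree_swap"
        unfolding ww_def by (simp only: tconj_pair_swap[OF w w] comp_id tinv_comp_cancel[OF w])
      finally have "tconj ww tree_swap = tree_swap" by (simp only: tree_pair_id id_comp)
      then have "F k = tconj ww (tconj id (S k))"
        unfolding 1 S_def sum.case tconj_id(1) using F1 by (simp only: One_nat_def a_1)
      then show ?thesis using agree_refl G_closed(1) by (metis (no_types))
    next
      case 2
      obtain f where f: "f \<in> G" "tree_pair \<gamma> (tinv \<gamma>) \<circ> tree_swap = tconj f (S (Inr 1))"
        using swapped_conj_b_1[OF \<gamma>(1,3)] by blast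
      have a: "agree_to_level n c (tconj w \<gamma>)" using c\<gamma> unfolding \<gamma>_def .
      then have "agree_to_level n (tinv c) (tinv (tconj w \<gamma>))" using c \<gamma> w by (intro agree_inv) auto
      then have "agree_to_level (Suc n) (F k) (tree_pair (tconj w \<gamma>) (tinv (tconj w \<gamma>)) \<circ> tree_swap)"
        unfolding 2 c(2) using a by (intro agree_comp agree_pair agree_refl tree_swap_in)
      also have "tree_pair (tconj w \<gamma>) (tinv (tconj w \<gamma>)) \<circ> tree_swap = tconj ww (tree_pair \<gamma> (tinv \<gamma>) \<circ> tree_swap)"
        unfolding ww_def tconj_pair_swap[OF w w] tinv_tconj[OF w \<gamma>(2)] unfolding tconj_def ..
      also have "\<dots> = tconj ww (tconj f (S k))" unfolding f(2) 2 ..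
      finally show ?thesis using f(1) by blast
    next
      case 3
      obtain f where f: "f \<in> G" "tree_pair (e1 k) (e2 k) = tconj f (S k)"
        unfolding e1_def e2_def using pair_of_conjugates[OF 3 g[OF pred_index_in[OF 3]] g[OF rK]] by blast
      have fA: "f \<in> AutT" using f G_closed(4) by blast
      show ?thesis
      proof (cases "s k")
        case True
        \<comment> \<open>The components sit in reversed order here; this is corrected by
          conjugating with the swap, which belongs to \<open>G\<close>.\<close>
        have "agree_to_level (Suc n) (F k) (tree_pair (tconj w (e2 k)) (tconj w (e1 k)))"
          unfolding Fp[OF 3] if_P[OF True] by (intro agree_pair e1(3)[OF 3] e2(3)[OF 3])
        also have "tree_pair (tconj w (e2 k)) (tconj w (e1 k)) = tconj ww (tconj tree_swap (tree_pair (e1 k) (e2 k)))"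
          unfolding ww_def tconj_swap_pair tconj_pair[OF w w] ..
        also have "\<dots> = tconj ww (tconj (tree_swap \<circ> f) (S k))"
          unfolding f(2) tconj_tconj[OF tree_swap_in fA] ..
        finally show ?thesis using G_closed(2)[OF swap_in_G f(1)] by blast
      next
        case False
        have "agree_to_level (Suc n) (F k) (tree_pair (tconj w (e1 k)) (tconj w (e2 k)))"
          unfolding Fp[OF 3] if_not_P[OF False] by (intro agree_pair e1(3)[OF 3] e2(3)[OF 3])
        also have "tree_pair (tconj w (e1 k)) (tconj w (e2 k)) = tconj ww (tconj f (S k))"
          unfolding ww_def f(2)[symmetric] tconj_pair[OF w w] ..
        finally show ?thesis using f(1) by blast
      qed
    qed
  qed
  then show ?thesis unfolding conjugate_to_level_def using ww by blast
qed

end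

section \<open>From the given recursion and infinite product to finite products\<close>

lemma agree_all_levels: "(\<And>n. agree_to_level n f g) \<Longrightarrow> f = g"
  unfolding agree_to_level_def by blast

lemma nontrivial_iff: "nontrivial_on_level n f \<longleftrightarrow> \<not> agree_to_level n f id"
  by (auto simp: nontrivial_on_level_def agree_to_level_def)

lemma conjugate_recursion_imp_family:
  assumes r: "r \<ge> 1" and rec: "conjugate_recursion r a b"
  shows "conjugate_recursion_family r (case_sum a b)"
  unfolding conjugate_recursion_family_def
proof (intro conjI ballI)
  note rec = rec[unfolded conjugate_recursion_def tree_aut_simps]
  show "case_sum a b (Inl 1) \<sim>\<^sub>W tree_swap" "case_sum a b (Inr 1) \<sim>\<^sub>W tree_swap"
    unfolding sum.case using rec by blast+
  fix p assume "p \<in> recursion_indices r"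
  then show "case_sum a b p \<sim>\<^sub>W tree_pair (case_sum a b (pred_index p)) (second_child r (case_sum a b) p)"
  proof (cases rule: recursion_indices_cases)
    case (Inl i)
    show ?thesis
    proof (cases "i = r")
      case True
      have "a (Suc r) \<sim>\<^sub>W tree_pair (a r) (b r)" using rec by (simp only: Suc_eq_plus1)
      then show ?thesis unfolding Inl(3) unfolding Inl(1) True second_child_simps sum.case .
    next
      case False
      then have "p \<noteq> Inl (Suc r)" using Inl by simp
      have "1 < Suc i" "Suc i \<noteq> r + 1" using Inl False by auto
      then have "a (Suc i) \<sim>\<^sub>W tree_pair (a (Suc i - 1)) id" using rec by blast
      then show ?thesis
        unfolding second_child_simps(2)[OF \<open>p \<noteq> _\<close>] Inl(3) unfolding Inl(1) sum.case diff_Suc_1 .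
    qed
  next
    case (Inr j)
    then have "p \<noteq> Inl (Suc r)" by simp
    have "1 < Suc j \<and> Suc j \<le> r" using Inr by auto
    then have "b (Suc j) \<sim>\<^sub>W tree_pair (b (Suc j - 1)) id" using rec by blast
    then show ?thesis
      unfolding second_child_simps(2)[OF \<open>p \<noteq> _\<close>] Inr(4) unfolding Inr(1) sum.case diff_Suc_1 .
  qed
qed

text \<open>Members acting trivially to level \<open>n\<close> may be appended to the finite product
  without changing it there, which fills the list up to a complete set
  \<open>first_indices r N\<close>.\<close>

lemma product_one_at_level:
  assumes F: "\<And>k. k \<in> all_indices r \<Longrightarrow> F k \<in> AutT" and prod: "ordered_product_one (all_indices r) R F"
  shows "\<exists>N ks. n + r \<le> N \<and> distinct ks \<and> set ks = first_indices r N \<and>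
    agree_to_level n (lprod (map F ks)) id"
proof -
  obtain ks where ks: "distinct ks" "set ks = {k \<in> all_indices r. nontrivial_on_level n (F k)}"
    "\<not> nontrivial_on_level n (foldr (\<lambda>k g. F k \<circ> g) ks id)"
    using prod unfolding ordered_product_one_def tree_aut_simps by blast
  have "foldr (\<lambda>k g. F k \<circ> g) ks id = lprod (map F ks)"
    unfolding lprod_def foldr_map comp_def[of "(\<circ>)" F] ..
  then have prod1: "agree_to_level n (lprod (map F ks)) id" using ks(3) by (simp only: nontrivial_iff simp_thms)
  have "finite (Inl -` set ks :: nat set)" by (intro finite_vimageI) auto
  then obtain B where B: "\<And>i. Inl i \<in> set ks \<Longrightarrow> i \<le> B"
    unfolding finite_nat_set_iff_bounded_le by blast
  \<comment> \<open>\<open>B\<close> bounds the indices that occur in \<open>ks\<close>. The surplus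
    \<open>n + r\<close> lets the bound drop by one at each of \<open>n\<close> descents and still
    be at least \<open>r\<close>.\<close>
  define N where "N = B + n + r"
  have sub: "set ks \<subseteq> first_indices r N"
  proof
    fix k assume k: "k \<in> set ks"
    then have "k \<in> all_indices r" using ks by blast
    then show "k \<in> first_indices r N" using B k by (cases k) (auto simp: N_def intro: trans_le_add1)
  qed
  have "finite (first_indices r N - set ks)" by (simp add: first_indices_def)
  then obtain ls where ls: "set ls = first_indices r N - set ks" "distinct ls"
    using finite_distinct_list by blast
  have lsK: "k \<in> all_indices r" "agree_to_level n (F k) id" if "k \<in> set ls" for k
  proof -
    show "k \<in> all_indices r" using that ls by (auto simp: first_indices_def all_indices_def)
    then show "agree_to_level n (F k) id" using that ls ks(2) by (simp only: nontrivial_iff) blast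
  qed
  have triv: "lprod (map (\<lambda>k. id) ls) = id" by (induction ls) (simp_all only: list.map lprod_Nil lprod_Cons id_comp)
  have "agree_to_level n (lprod (map F ls)) (lprod (map (\<lambda>k. id) ls))"
    by (intro lprod_agree F lsK)
  then have prod2: "agree_to_level n (lprod (map F ls)) id" unfolding triv .
  have "lprod (map F ls) \<in> AutT" by (intro lprod_closed F lsK)
  then have "agree_to_level n (lprod (map F ks) \<circ> lprod (map F ls)) (id \<circ> id)"
    using prod1 prod2 by (intro agree_comp)
  then have "agree_to_level n (lprod (map F (ks @ ls))) id"
    unfolding map_append lprod_append id_comp .
  moreover have "distinct (ks @ ls)" "set (ks @ ls) = first_indices r N" "n + r \<le> N"
    using ks ls sub by (auto simp: N_def)
  ultimately show ?thesis by blast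
qed

lemma tconj_hom:
  assumes "w \<in> AutT" shows "group_hom tree_aut tree_aut (tconj w)"
proof (intro group_hom.intro group_hom_axioms.intro tree_aut_group homI)
  show "tconj w x \<in> AutT" if "x \<in> AutT" for x using assms that by blast
  show "tconj w (x \<otimes>\<^bsub>tree_aut\<^esub> y) = tconj w x \<otimes>\<^bsub>tree_aut\<^esub> tconj w y" for x y
    unfolding tree_aut_simps by (rule tconj_comp[OF assms])
qed

section \<open>Induction over the levels and passage to the whole tree\<close>

context std_gens
begin

text \<open>Induction with \<open>level_step\<close>, after normalizing \<open>F (Inl 1)\<close> to
  the swap. In each step \<open>n\<close> and \<open>N\<close> both drop by one, so
  \<open>n + r \<le> N\<close> persists.\<close>

lemma level_conjugation:
  assumes "\<And>k. k \<in> all_indices r \<Longrightarrow> F k \<in> AutT" "conjugate_recursion_family r F" "n + r \<le> N"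
    and "distinct ks" "set ks = first_indices r N" "agree_to_level n (lprod (map F ks)) id"
  shows "\<exists>w. conjugate_to_level n F w"
  using assms
proof (induction n arbitrary: F N ks)
  case 0
  have "agree_to_level 0 (F k) (tconj id (tconj id (S k)))" if "k \<in> all_indices r" for k
    unfolding tconj_id(1) using 0(1) S_in that by (intro agree_0)
  then have "conjugate_to_level 0 F id"
    unfolding conjugate_to_level_def using G_closed(1) id_closed by blast
  then show ?case by blast
next
  case (Suc n)
  note F = Suc.prems(1) and rec = Suc.prems(2)
  obtain h where h: "h \<in> AutT" "F (Inl 1) = tconj h tree_swap"
    using rec unfolding conjugate_recursion_family_def conjugate_under_iff by blast
  obtain M where M: "N = Suc M" "n + r \<le> M" using Suc.prems(3) by (cases N) auto
  \<comment> \<open>Simultaneous conjugation preserves the product relation, the recursion being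
    stable under conjugation of each member, and makes the first member equal to the swap.\<close>
  define F0 where "F0 k = tconj (tinv h) (F k)" for k
  have hi: "tinv h \<in> AutT" using h by blast
  have F0: "F0 k \<in> AutT" "F0 k \<sim>\<^sub>W F k" "F k = tconj h (F0 k)" if "k \<in> all_indices r" for k
    using F[OF that] hi h unfolding F0_def conjugate_under_iff by (auto simp only: tconj_closed tconj_cancel)
  have "\<exists>w. conjugate_to_level (Suc n) F0 w"
  proof (rule level_step[where N = M and ks = ks])
    show "conjugate_recursion_family r F0" by (rule conjugate_recursion_family_cong[OF r rec F0(2)])
    show "F0 (Inl 1) = tree_swap" unfolding F0_def h(2) using h(1) by (rule tconj_cancel)
    show "agree_to_level (Suc n) (lprod (map F0 ks)) id"
    proof -
      have "agree_to_level (Suc n) (tconj (tinv h) (lprod (map F ks))) (tconj (tinv h) id)"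
      proof (intro agree_tconj agree_refl hi id_closed)
        show "lprod (map F ks) \<in> AutT"
          using Suc.prems(5) by (intro lprod_closed F) (auto simp: first_indices_def all_indices_def)
      qed (rule Suc.prems(6))
      moreover have "lprod (map F0 ks) = tconj (tinv h) (lprod (map F ks))"
        unfolding F0_def by (rule lprod_tconj[OF hi])
      ultimately show ?thesis by (simp only: tconj_id(2)[OF hi])
    qed
    show "set ks = first_indices r (Suc M)" using Suc.prems(5) M by simp
    show "\<exists>w. conjugate_to_level n F w"
      if "\<And>k. k \<in> all_indices r \<Longrightarrow> F k \<in> AutT" "conjugate_recursion_family r F" "distinct ks"
        "set ks = first_indices r M" "agree_to_level n (lprod (map F ks)) id" for F ks
      by (rule Suc.IH[OF that(1,2) M(2) that(3-5)])
  qed (use F0 M Suc.prems in auto)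
  then obtain w where w: "w \<in> AutT"
    "\<And>k. k \<in> all_indices r \<Longrightarrow> \<exists>g\<in>G. agree_to_level (Suc n) (F0 k) (tconj w (tconj g (S k)))"
    unfolding conjugate_to_level_def by blast
  have "\<exists>g\<in>G. agree_to_level (Suc n) (F k) (tconj (h \<circ> w) (tconj g (S k)))" if k: "k \<in> all_indices r" for k
  proof -
    obtain g where g: "g \<in> G" "agree_to_level (Suc n) (F0 k) (tconj w (tconj g (S k)))"
      using w(2)[OF k] by blast
    then have gA: "g \<in> AutT" using G_closed(4) by blast
    have "agree_to_level (Suc n) (tconj h (F0 k)) (tconj h (tconj w (tconj g (S k))))"
      using h w F0(1)[OF k] S_in[OF k] gA by (intro agree_tconj agree_refl g(2)) blast+
    then show ?thesis using g(1) unfolding F0(3)[OF k, symmetric] tconj_tconj[OF h(1) w(1)] by blast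
  qed
  then have "conjugate_to_level (Suc n) F (h \<circ> w)"
    unfolding conjugate_to_level_def using h w by blast
  then show ?case by blast
qed

lemma G_limit:
  assumes "f \<in> AutT" "\<And>n. \<exists>g\<in>G. agree_to_level n g f" shows "f \<in> G"
proof -
  have "\<exists>h\<in>\<Gamma>. agree_to_level n h f" for n
  proof -
    obtain g where "g \<in> G" "agree_to_level n g f" using assms(2) by blast
    moreover from this obtain h where "h \<in> \<Gamma>" "agree_to_level n h g" unfolding G_iff by blast
    ultimately show ?thesis using agree_trans by blast
  qed
  then show ?thesis unfolding G_iff using assms(1) by blast
qed

text \<open>Compactness is used twice: first for the conjugators of all levels, giving one
  \<open>w\<close> for the whole family, and then for each \<open>k\<close> separately for the
  elements of \<open>G\<close>, which is closed.\<close>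

lemma simultaneous_conjugation:
  assumes F: "\<And>k. k \<in> all_indices r \<Longrightarrow> F k \<in> AutT" and lev: "\<And>n. \<exists>w. conjugate_to_level n F w"
  shows "\<exists>w\<in>AutT. \<forall>k\<in>all_indices r. \<exists>g\<in>G. F k = tconj w (tconj g (S k))"
proof -
  obtain v where v: "\<And>n. conjugate_to_level n F (v n)" using lev by metis
  have vA: "v n \<in> AutT" for n using v[of n] unfolding conjugate_to_level_def by blast
  obtain w where w: "w \<in> AutT" "\<And>n. \<exists>m\<ge>n. agree_to_level n (v m) w"
    using aut_accumulation_point[of v, OF vA] by blast
  have "\<exists>g\<in>G. F k = tconj w (tconj g (S k))" if k: "k \<in> all_indices r" for k
  proof -
    have "\<exists>g\<in>G. agree_to_level n (F k) (tconj w (tconj g (S k)))" for n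
    proof -
      obtain m where m: "m \<ge> n" "agree_to_level n (v m) w" using w(2) by blast
      obtain g where g: "g \<in> G" "agree_to_level m (F k) (tconj (v m) (tconj g (S k)))"
        using v[of m] k unfolding conjugate_to_level_def by blast
      then have gA: "g \<in> AutT" using G_closed(4) by blast
      have "agree_to_level n (F k) (tconj (v m) (tconj g (S k)))" using g(2) m(1) by (rule agree_mono)
      moreover have "agree_to_level n (tconj (v m) (tconj g (S k))) (tconj w (tconj g (S k)))"
        using vA w(1) gA S_in[OF k] by (intro agree_tconj m(2) agree_refl) blast+
      ultimately show ?thesis using g(1) agree_trans by blast
    qed
    then obtain g where g: "\<And>n. g n \<in> G" "\<And>n. agree_to_level n (F k) (tconj w (tconj (g n) (S k)))"
      by metis
    have gA: "g n \<in> AutT" for n using g(1) G_closed(4) by blast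
    \<comment> \<open>With \<open>w\<close> fixed, the elements \<open>g n\<close> for this
      \<open>k\<close> accumulate at some \<open>u\<close>, which lies in \<open>G\<close> because
      \<open>G\<close> is closed.\<close>
    obtain u where u: "u \<in> AutT" "\<And>n. \<exists>m\<ge>n. agree_to_level n (g m) u"
      using aut_accumulation_point[of g, OF gA] by blast
    have "u \<in> G" using u(2) g(1) by (intro G_limit[OF u(1)]) blast
    moreover have "F k = tconj w (tconj u (S k))"
    proof (rule agree_all_levels)
      fix n
      obtain m where m: "m \<ge> n" "agree_to_level n (g m) u" using u(2) by blast
      have "agree_to_level n (F k) (tconj w (tconj (g m) (S k)))" using g(2) m(1) by (rule agree_mono)
      moreover have "agree_to_level n (tconj w (tconj (g m) (S k))) (tconj w (tconj u (S k)))"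
        using w(1) gA u(1) S_in[OF k] by (intro agree_tconj m(2) agree_refl) blast+
      ultimately show "agree_to_level n (F k) (tconj w (tconj u (S k)))" by (rule agree_trans)
    qed
    ultimately show ?thesis by blast
  qed
  then show ?thesis using w(1) by blast
qed

section \<open>The closed subgroup generated by conjugates of the generators\<close>

lemma \<Gamma>_eq: "\<Gamma> = generate tree_aut (S ` all_indices r)"
  unfolding \<Gamma>_def S_def all_indices_def case_sum_image_Plus ..

text \<open>Conjugation by \<open>w\<close> is a homeomorphic automorphism and can be split off. The
  remaining elements \<open>t k\<close> lie in \<open>G\<close>, and the group they generate is
  dense in \<open>G\<close> because at each finite level the generators act through a
  2-group.\<close>

lemma closure_generated_by_conjugates:
  assumes w: "w \<in> AutT" and F: "\<And>k. k \<in> all_indices r \<Longrightarrow> \<exists>g\<in>G. F k = tconj w (tconj g (S k))"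
  shows "tree_aut_topology closure_of generate tree_aut (F ` all_indices r) = tconj w ` G"
proof -
  obtain g where g: "\<And>k. k \<in> all_indices r \<Longrightarrow> g k \<in> G"
    and Fg: "\<And>k. k \<in> all_indices r \<Longrightarrow> F k = tconj w (tconj (g k) (S k))"
    using F by metis
  have gA: "g k \<in> AutT" if "k \<in> all_indices r" for k using g[OF that] G_closed(4) by blast
  define t where "t k = tconj (g k) (S k)" for k
  have tG: "t k \<in> G" if "k \<in> all_indices r" for k
    unfolding t_def tconj_def using g[OF that] S_in_G[OF that] by (intro G_closed)
  have tA: "t ` all_indices r \<subseteq> AutT" using tG G_closed(4) by blast
  have "F ` all_indices r = (\<lambda>k. tconj w (t k)) ` all_indices r" using Fg by (intro image_cong) (auto simp only: t_def)
  then have "F ` all_indices r = tconj w ` (t ` all_indices r)" by (simp only: image_image)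
  then have gen: "generate tree_aut (F ` all_indices r) = tconj w ` generate tree_aut (t ` all_indices r)"
    by (simp only: group_hom.generate_img[OF tconj_hom[OF w] tA])
  define T where "T = generate tree_aut (t ` all_indices r)"
  have TG: "T \<subseteq> G"
    unfolding T_def using tG by (intro group.generate_subgroup_incl[OF tree_aut_group _ G_subgroup]) blast
  then have TA: "T \<subseteq> AutT" using G_closed(4) by blast
  have dense: "\<exists>h\<in>T. agree_to_level n h y" if y: "y \<in> G" for n y
  proof -
    obtain y' where y': "y' \<in> \<Gamma>" "agree_to_level n y' y" using y unfolding G_iff by blast
    \<comment> \<open>The conjugators \<open>g k\<close> lie only in the closure of \<Gamma>. At
      level \<open>n\<close> they are replaced by elements of \<Gamma> itself, as
      \<open>conjugates_generate_to_level\<close> requires.\<close>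
    have "\<exists>z\<in>\<Gamma>. agree_to_level n z (g k)" if "k \<in> all_indices r" for k
      using g[OF that] unfolding G_iff by blast
    then obtain z where z: "\<And>k. k \<in> all_indices r \<Longrightarrow> z k \<in> \<Gamma>"
      "\<And>k. k \<in> all_indices r \<Longrightarrow> agree_to_level n (z k) (g k)" by metis
    have "\<exists>h\<in>generate tree_aut (t ` all_indices r). agree_to_level n h y'"
    proof (rule conjugates_generate_to_level[where s = S and g = z])
      show "agree_to_level n (t k) (tconj (z k) (S k))" if k: "k \<in> all_indices r" for k
        unfolding t_def using gA[OF k] S_in[OF k] \<Gamma>_closed(4)[OF z(1)[OF k]]
        by (intro agree_tconj agree_refl agree_sym[OF z(2)[OF k]])
    qed (use S_in tA z(1) y'(1) in \<open>auto simp: \<Gamma>_eq\<close>)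
    then show ?thesis unfolding T_def using y'(2) agree_trans by blast
  qed
  have imA: "tconj w ` T \<subseteq> AutT" using TA w by blast
  have wi: "tinv w \<in> AutT" using w by blast
  show ?thesis
    unfolding gen T_def[symmetric]
  proof (intro equalityI subsetI)
    fix f assume "f \<in> tree_aut_topology closure_of (tconj w ` T)"
    then have f: "f \<in> AutT" "\<And>n. \<exists>h\<in>T. agree_to_level n (tconj w h) f"
      unfolding in_tree_aut_closure_iff[OF imA] by blast+
    have "tconj (tinv w) f \<in> G"
    proof (rule G_limit)
      show "tconj (tinv w) f \<in> AutT" using wi f by blast
      fix n
      obtain h where h: "h \<in> T" "agree_to_level n (tconj w h) f" using f(2) by blast
      then have hA: "h \<in> AutT" using TA by blast
      have "agree_to_level n (tconj (tinv w) (tconj w h)) (tconj (tinv w) f)"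
        using wi f(1) hA w by (intro agree_tconj agree_refl h(2)) blast+
      then have "agree_to_level n h (tconj (tinv w) f)" unfolding tconj_cancel(2)[OF w] .
      then show "\<exists>g\<in>G. agree_to_level n g (tconj (tinv w) f)" using h(1) TG by blast
    qed
    then show "f \<in> tconj w ` G"
      by (rule rev_image_eqI) (rule tconj_cancel(1)[OF w, symmetric])
  next
    fix f assume "f \<in> tconj w ` G"
    then obtain y where y: "y \<in> G" "f = tconj w y" by blast
    have yA: "y \<in> AutT" using y G_closed(4) by blast
    have "\<exists>h\<in>T. agree_to_level n (tconj w h) f" for n
    proof -
      obtain h where h: "h \<in> T" "agree_to_level n h y" using dense[OF y(1)] by blast
      have "agree_to_level n (tconj w h) (tconj w y)"
        using w yA h(1) TA by (intro agree_tconj agree_refl h(2)) blast+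
      then show ?thesis using h(1) y(2) by blast
    qed
    then show "f \<in> tree_aut_topology closure_of (tconj w ` T)"
      unfolding in_tree_aut_closure_iff[OF imA] using y(2) w yA by blast
  qed
qed

end

section \<open>Simultaneous conjugation into \<open>G\<close> and the resulting closed
  subgroup\<close>

theorem theorem4p5p1:
  fixes r :: nat
    and a b a' b' :: "nat \<Rightarrow> vertex \<Rightarrow> vertex"
    and G :: "(vertex \<Rightarrow> vertex) set"
    and conjugates_to_generators :: "(vertex \<Rightarrow> vertex) \<Rightarrow> bool"
  defines "G \<equiv> closed_subgroup_gen r a b"
    and "conjugates_to_generators \<equiv> (\<lambda>w.
      (\<forall>i\<ge>1. conjugate_under G (inv\<^bsub>tree_aut\<^esub> w \<otimes>\<^bsub>tree_aut\<^esub> a' i \<otimes>\<^bsub>tree_aut\<^esub> w) (a i)) \<and>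
      (\<forall>j\<in>{1..r}. conjugate_under G (inv\<^bsub>tree_aut\<^esub> w \<otimes>\<^bsub>tree_aut\<^esub> b' j \<otimes>\<^bsub>tree_aut\<^esub> w) (b j)))"
  assumes "r \<ge> 1"
    and "standard_generators r a b"
    and "tree_aut_families r a' b'"
    and "conjugate_recursion r a' b'"
    and "product_one_some_order r a' b'"
  shows "(\<exists>w\<in>carrier tree_aut. conjugates_to_generators w) \<and>
         (\<forall>w\<in>carrier tree_aut. conjugates_to_generators w \<longrightarrow>
            closed_subgroup_gen r a' b' =
              (\<lambda>g. w \<otimes>\<^bsub>tree_aut\<^esub> g \<otimes>\<^bsub>tree_aut\<^esub> inv\<^bsub>tree_aut\<^esub> w) ` G)"
proof -
  interpret gens: std_gens r a b using assms(3,4) by unfold_locales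
  have G: "G = gens.G" unfolding G_def gens.G_def ..
  define F where "F = case_sum a' b'"
  have F: "F k \<in> AutT" if "k \<in> all_indices r" for k
    using assms(5) that by (cases k) (auto simp: F_def tree_aut_families_def)
  have rec: "conjugate_recursion_family r F"
    unfolding F_def by (rule conjugate_recursion_imp_family[OF assms(3,6)])
  obtain R where R: "ordered_product_one (all_indices r) R F"
    using assms(7) unfolding product_one_some_order_def all_indices_def F_def by blast
  have lev: "\<exists>w. gens.conjugate_to_level n F w" for n
  proof -
    obtain N ks where "n + r \<le> N" "distinct ks" "set ks = first_indices r N"
      "agree_to_level n (lprod (map F ks)) id"
      using product_one_at_level[OF F R, of n] by blast
    then show ?thesis using gens.level_conjugation[OF F rec] by blast
  qed
  \<comment> \<open>Moving \<open>w\<close> to the other side brings the condition into the form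
    used for combined families.\<close>
  have conj_iff: "conjugate_under G (tinv w \<circ> x \<circ> w) y \<longleftrightarrow> (\<exists>g\<in>gens.G. x = tconj w (tconj g y))"
    if w: "w \<in> AutT" for w x y
  proof -
    have 1: "tinv w \<circ> x \<circ> w = tconj (tinv w) x" unfolding tconj_def tinv_tinv[OF w] ..
    have "tconj (tinv w) x = z \<longleftrightarrow> x = tconj w z" for z
      using tconj_cancel[OF w] by metis
    then show ?thesis unfolding conjugate_under_iff 1 G by blast
  qed
  have iff: "conjugates_to_generators w \<longleftrightarrow>
      (\<forall>k\<in>all_indices r. \<exists>g\<in>gens.G. F k = tconj w (tconj g (gens.S k)))" (is "_ \<longleftrightarrow> (\<forall>k\<in>_. ?P k)")
    if w: "w \<in> AutT" for w
  proof -
    have "(\<forall>k\<in>all_indices r. ?P k) \<longleftrightarrow> (\<forall>i\<ge>1. ?P (Inl i)) \<and> (\<forall>j\<in>{1..r}. ?P (Inr j))"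
      unfolding all_indices_def by (auto simp only: Plus_def)
    then show ?thesis
      unfolding conjugates_to_generators_def tree_aut_simps conj_iff[OF w] F_def gens.S_def sum.case
      by (simp only:)
  qed
  have "\<exists>w\<in>AutT. conjugates_to_generators w"
    using gens.simultaneous_conjugation[OF F lev] iff by blast
  moreover have "closed_subgroup_gen r a' b' = (\<lambda>g. w \<circ> g \<circ> tinv w) ` G"
    if w: "w \<in> AutT" and c: "conjugates_to_generators w" for w
  proof -
    have "closed_subgroup_gen r a' b' = tree_aut_topology closure_of generate tree_aut (F ` all_indices r)"
      unfolding closed_subgroup_gen_def F_def all_indices_def case_sum_image_Plus ..
    also have "\<dots> = tconj w ` gens.G"
      using c unfolding iff[OF w] by (intro gens.closure_generated_by_conjugates[OF w]) blast
    finally show ?thesis unfolding G tconj_def .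
  qed
  ultimately show ?thesis unfolding tree_aut_simps by blast
qed

end
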